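(* Let $k<n$, let $T$ be a positive plurisubharmonic current of bidegree $(k,k)$ on $\mathbb{C}^N=\mathbb{C}^n\times\mathbb{C}^m$ ($N=n+m$), and let $D$ be a relatively compact Borel subset of $\mathbb{C}^m$. If $T$ is of finite order $\varrho$, then $T$ has finite directional order $\varrho_{(T,D)}$, and $\varrho_{(T,D)}\le 2m+\varrho$.
   Context: Notation: $\mathbb{B}_j(r)=\{x\in\mathbb{C}^j:|x|<r\}$, $d=\partial+\overline\partial$, $d^c=\frac{i}{4\pi}(\overline\partial-\partial)$; for $(z,t)\in\mathbb{C}^n\times\mathbb{C}^m$, $\beta_z=dd^c|z|^2$ and $\beta_t=dd^c|t|^2$. A current $T$ of bidegree $(k,k)$ (bidimension $(N-k,N-k)$) on $\mathbb{C}^N$ is positive if $T\wedge i\alpha_1\wedge\overline\alpha_1\wedge\dots\wedge i\alpha_{N-k}\wedge\overline\alpha_{N-k}$ is a positive measure for all smooth compactly supported $(1,0)$-forms $\alpha_j$; it is plurisubharmonic if $dd^cT$ is a positive current. Order: with $\nu_T(r)=\frac{1}{r^{2(N-k)}}\int_{\mathbb{B}_N(r)}T\wedge(\beta_z+\beta_t)^{N-k}$, the order of $T$ is $\varrho=\limsup_{r\to+\infty}\frac{\log\nu_T(r)}{\log r}$, and $T$ is of finite order if $\varrho<+\infty$. Directional order of $T$ with respect to $D$ in the direction of $\mathbb{C}^n$: $\varrho_{(T,D)}=\limsup_{r\to+\infty}\frac{\log\mathscr{N}_{(T,D)}(r)}{\log r}$, where $\mathscr{N}_{(T,D)}(r)=\frac{1}{r^{2(n-k)}}\int_{\mathbb{B}_n(r)\times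 D}T\wedge\beta_z^{n-k}\wedge\beta_t^m$; it is finite if it is $<+\infty$ (with $\log0=-\infty$). *)

theory Defs
  imports "HOL-Analysis.Analysis" "HOL-Library.Function_Algebras"
begin

type_synonym ('n, 'm) cspace = "(complex, 'n) vec \<times> (complex, 'm) vec"

abbreviation cdim :: "('n::finite, 'm::finite) cspace itself \<Rightarrow> nat" where
  "cdim _ \<equiv> CARD('n) + CARD('m)"

definition imul :: "('n::finite, 'm::finite) cspace \<Rightarrow> ('n, 'm) cspace" where
  "imul x = (\<i> *s fst x, \<i> *s snd x)"


section \<open>Smooth functions\<close>

primrec iter_deriv :: "'a::euclidean_space list \<Rightarrow> ('a \<Rightarrow> complex) \<Rightarrow> 'a \<Rightarrow> complex" where
  "iter_deriv [] f = f"
| "iter_deriv (u # us) f = (\<lambda>x. frechet_derivative (iter_deriv us f) (at x) u)"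

definition smooth :: "('a::euclidean_space \<Rightarrow> complex) \<Rightarrow> bool" where
  "smooth f \<longleftrightarrow> (\<forall>us x. iter_deriv us f differentiable (at x))"


section \<open>Exterior algebra\<close>

text \<open>
  An element of the complexified exterior algebra of the dual of a real vector space is
  represented by its values on lists of vectors; a form of degree \<open>q\<close> vanishes on all lists whose
  length is not \<open>q\<close>. The wedge product is the sum over all shuffles, normalised so that
  \<open>(a \<and> b)(v, w) = a(v) b(w) - a(w) b(v)\<close> for one-forms \<open>a\<close> and \<open>b\<close>.
  Note that the operations \<open>+\<close> and \<open>0\<close> on forms are pointwise, whereas the pointwise
  product of functions is never used as a product of forms.
\<close>

definition wedge :: "('v list \<Rightarrow> complex) \<Rightarrow> ('v list \<Rightarrow> complex) \<Rightarrow> 'v list \<Rightarrow> complex" where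
  "wedge a b vs = (\<Sum>S\<in>Pow {..<length vs}.
     (-1) ^ card {(i, j). i \<in> S \<and> j \<notin> S \<and> j < i} * a (nths vs S) * b (nths vs (- S)))"

definition scalar_form :: "complex \<Rightarrow> 'v list \<Rightarrow> complex" where
  "scalar_form c vs = (if vs = [] then c else 0)"

definition covector :: "('v \<Rightarrow> complex) \<Rightarrow> 'v list \<Rightarrow> complex" where
  "covector l vs = (if length vs = 1 then l (hd vs) else 0)"

definition covectors10 :: "(('n::finite, 'm::finite) cspace list \<Rightarrow> complex) set" where
  "covectors10 = {covector l | l. linear l \<and> (\<forall>v. l (imul v) = \<i> * l v)}"

definition covectors01 :: "(('n::finite, 'm::finite) cspace list \<Rightarrow> complex) set" where
  "covectors01 = {covector l | l. linear l \<and> (\<forall>v. l (imul v) = - \<i> * l v)}"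

definition bidegree :: "nat \<Rightarrow> nat \<Rightarrow> (('n::finite, 'm::finite) cspace list \<Rightarrow> complex) set" where
  "bidegree p q = module.span (\<lambda>c a vs. c * a vs)
     {foldr wedge (as @ bs) (scalar_form 1) | as bs.
        set as \<subseteq> covectors10 \<and> length as = p \<and> set bs \<subseteq> covectors01 \<and> length bs = q}"


section \<open>Differential forms\<close>

type_synonym ('n, 'm) dform = "('n, 'm) cspace \<Rightarrow> ('n, 'm) cspace list \<Rightarrow> complex"

definition fscale :: "complex \<Rightarrow> ('n::finite, 'm::finite) dform \<Rightarrow> ('n, 'm) dform" where
  "fscale c \<omega> = (\<lambda>x vs. c * \<omega> x vs)"

definition fcnj :: "('n::finite, 'm::finite) dform \<Rightarrow> ('n, 'm) dform" where
  "fcnj \<omega> = (\<lambda>x vs. cnj (\<omega> x vs))"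

definition fwedge :: "('n::finite, 'm::finite) dform \<Rightarrow> ('n, 'm) dform \<Rightarrow> ('n, 'm) dform"
    (infixr "\<and>\<^sub>F" 70) where
  "\<omega> \<and>\<^sub>F \<eta> = (\<lambda>x. wedge (\<omega> x) (\<eta> x))"

definition func_form :: "(('n::finite, 'm::finite) cspace \<Rightarrow> complex) \<Rightarrow> ('n, 'm) dform" where
  "func_form f = (\<lambda>x. scalar_form (f x))"

definition fwedge_list :: "('n::finite, 'm::finite) dform list \<Rightarrow> ('n, 'm) dform" where
  "fwedge_list \<omega>s = foldr (\<and>\<^sub>F) \<omega>s (func_form (\<lambda>_. 1))"

abbreviation fwedge_power :: "('n::finite, 'm::finite) dform \<Rightarrow> nat \<Rightarrow> ('n, 'm) dform"
    (infixr "^\<^sub>F" 80) where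
  "\<omega> ^\<^sub>F p \<equiv> fwedge_list (replicate p \<omega>)"

text \<open>
  The complex linear and antilinear parts of the real differential of a function. Since they are
  applied to the coefficients of a form with respect to constant frames, replacing the differential
  by them in the usual formula for the exterior derivative gives \<open>\<partial>\<close> and its conjugate on forms of
  every bidegree.
\<close>

definition deriv10 :: "(('n::finite, 'm::finite) cspace \<Rightarrow> complex) \<Rightarrow> ('n, 'm) cspace \<Rightarrow> ('n, 'm) cspace \<Rightarrow> complex" where
  "deriv10 f x v = (frechet_derivative f (at x) v - \<i> * frechet_derivative f (at x) (imul v)) / 2"

definition deriv01 :: "(('n::finite, 'm::finite) cspace \<Rightarrow> complex) \<Rightarrow> ('n, 'm) cspace \<Rightarrow> ('n, 'm) cspace \<Rightarrow> complex" where
  "deriv01 f x v = (frechet_derivative f (at x) v + \<i> * frechet_derivative f (at x) (imul v)) / 2"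

definition del :: "('n::finite, 'm::finite) dform \<Rightarrow> ('n, 'm) dform" where
  "del \<omega> x vs = (\<Sum>i<length vs. (-1) ^ i * deriv10 (\<lambda>y. \<omega> y (nths vs (- {i}))) x (vs ! i))"

definition delbar :: "('n::finite, 'm::finite) dform \<Rightarrow> ('n, 'm) dform" where
  "delbar \<omega> x vs = (\<Sum>i<length vs. (-1) ^ i * deriv01 (\<lambda>y. \<omega> y (nths vs (- {i}))) x (vs ! i))"

definition ext_d :: "('n::finite, 'm::finite) dform \<Rightarrow> ('n, 'm) dform" where
  "ext_d \<omega> = del \<omega> + delbar \<omega>"

definition ext_dc :: "('n::finite, 'm::finite) dform \<Rightarrow> ('n, 'm) dform" where
  "ext_dc \<omega> = fscale (\<i> / (4 * of_real pi)) (delbar \<omega> - del \<omega>)"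

definition beta_z :: "('n::finite, 'm::finite) dform" where
  "beta_z = ext_d (ext_dc (func_form (\<lambda>(z, t). of_real ((norm z)\<^sup>2))))"

definition beta_t :: "('n::finite, 'm::finite) dform" where
  "beta_t = ext_d (ext_dc (func_form (\<lambda>(z, t). of_real ((norm t)\<^sup>2))))"

definition fsupport :: "('n::finite, 'm::finite) dform \<Rightarrow> ('n, 'm) cspace set" where
  "fsupport \<omega> = closure {x. \<omega> x \<noteq> 0}"

definition test_forms :: "nat \<Rightarrow> nat \<Rightarrow> ('n::finite, 'm::finite) dform set" where
  "test_forms p q = {\<phi>. (\<forall>x. \<phi> x \<in> bidegree p q) \<and> (\<forall>vs. smooth (\<lambda>x. \<phi> x vs)) \<and> compact (fsupport \<phi>)}"


section \<open>Currents\<close>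

text \<open>
  A current of bidegree \<open>(k, k)\<close> is a continuous linear functional on test forms of bidegree
  \<open>(N - k, N - k)\<close>; its values at other arguments are irrelevant. Continuity is sequential, with
  respect to uniform convergence of all derivatives of all coefficients, with supports in
  a fixed compact set.
\<close>

type_synonym ('n, 'm) functional = "('n, 'm) dform \<Rightarrow> complex"

definition test_null_sequence :: "(nat \<Rightarrow> ('n::finite, 'm::finite) dform) \<Rightarrow> bool" where
  "test_null_sequence \<phi> \<longleftrightarrow>
     (\<exists>K. compact K \<and> (\<forall>j. fsupport (\<phi> j) \<subseteq> K)) \<and>
     (\<forall>us vs. uniform_limit UNIV (\<lambda>j. iter_deriv us (\<lambda>x. \<phi> j x vs)) (\<lambda>_. 0) sequentially)"

definition current :: "nat \<Rightarrow> ('n::finite, 'm::finite) functional \<Rightarrow> bool" where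
  "current k T \<longleftrightarrow> (let N = cdim TYPE(('n, 'm) cspace); A = test_forms (N - k) (N - k) in
     k \<le> N \<and>
     (\<forall>\<phi>\<in>A. \<forall>\<psi>\<in>A. T (\<phi> + \<psi>) = T \<phi> + T \<psi>) \<and>
     (\<forall>c. \<forall>\<phi>\<in>A. T (fscale c \<phi>) = c * T \<phi>) \<and>
     (\<forall>\<phi>. range \<phi> \<subseteq> A \<and> test_null_sequence \<phi> \<longrightarrow> (\<lambda>j. T (\<phi> j)) \<longlonglongrightarrow> 0))"

definition current_wedge :: "('n::finite, 'm::finite) functional \<Rightarrow> ('n, 'm) dform \<Rightarrow> ('n, 'm) functional" where
  "current_wedge T \<eta> = (\<lambda>\<phi>. T (\<eta> \<and>\<^sub>F \<phi>))"

text \<open>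
  For currents of even degree, the sign rules for \<open>d\<close> and \<open>d\<^sup>c\<close> on currents combine to
  \<open>\<langle>dd\<^sup>c T, \<phi>\<rangle> = \<langle>T, dd\<^sup>c \<phi>\<rangle>\<close>.
\<close>

definition current_ddc :: "('n::finite, 'm::finite) functional \<Rightarrow> ('n, 'm) functional" where
  "current_ddc T = (\<lambda>\<phi>. T (ext_d (ext_dc \<phi>)))"

definition represented_by :: "('n::finite, 'm::finite) functional \<Rightarrow> ('n, 'm) cspace measure \<Rightarrow> bool" where
  "represented_by S M \<longleftrightarrow> sets M = sets borel \<and> (\<forall>K. compact K \<longrightarrow> emeasure M K < \<infinity>) \<and>
     (\<forall>\<phi>\<in>test_forms 0 0. S \<phi> = (LINT x|M. \<phi> x []))"

definition is_positive_measure :: "('n::finite, 'm::finite) functional \<Rightarrow> bool" where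
  "is_positive_measure S \<longleftrightarrow> (\<exists>M. represented_by S M)"

definition current_measure :: "('n::finite, 'm::finite) functional \<Rightarrow> ('n, 'm) cspace measure" where
  "current_measure S = (THE M. represented_by S M)"

definition positive_current :: "nat \<Rightarrow> ('n::finite, 'm::finite) functional \<Rightarrow> bool" where
  "positive_current k T \<longleftrightarrow> current k T \<and>
     (\<forall>\<alpha>s. set \<alpha>s \<subseteq> test_forms 1 0 \<and> length \<alpha>s = cdim TYPE(('n, 'm) cspace) - k \<longrightarrow>
        is_positive_measure (current_wedge T (fwedge_list (map (\<lambda>\<alpha>. fscale \<i> (\<alpha> \<and>\<^sub>F fcnj \<alpha>)) \<alpha>s))))"

text \<open>In top degree, \<open>k = N\<close>, the current \<open>dd\<^sup>c T\<close> is zero and there is nothing to require.\<close>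

definition plurisubharmonic :: "nat \<Rightarrow> ('n::finite, 'm::finite) functional \<Rightarrow> bool" where
  "plurisubharmonic k T \<longleftrightarrow>
     (k < cdim TYPE(('n, 'm) cspace) \<longrightarrow> positive_current (Suc k) (current_ddc T))"


section \<open>Order and directional order\<close>

definition elog :: "real \<Rightarrow> ereal" where
  "elog x = (if x = 0 then -\<infinity> else ereal (ln x))"

definition growth_order :: "(real \<Rightarrow> real) \<Rightarrow> ereal" where
  "growth_order f = Limsup at_top (\<lambda>r. elog (f r) / ereal (ln r))"

text \<open>
  The measures below are finite on bounded sets, so that the real-valued \<open>measure\<close> is
  the integral over the given set.
\<close>

definition nu :: "nat \<Rightarrow> ('n::finite, 'm::finite) functional \<Rightarrow> real \<Rightarrow> real" where
  "nu k T r = (let p = cdim TYPE(('n, 'm) cspace) - k in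
     1 / r ^ (2 * p) *
     measure (current_measure (current_wedge T ((beta_z + beta_t) ^\<^sub>F p))) (ball 0 r))"

definition current_order :: "nat \<Rightarrow> ('n::finite, 'm::finite) functional \<Rightarrow> ereal" where
  "current_order k T = growth_order (nu k T)"

definition directional_nu :: "nat \<Rightarrow> ('n::finite, 'm::finite) functional \<Rightarrow> (complex^'m) set \<Rightarrow> real \<Rightarrow> real" where
  "directional_nu k T D r = 1 / r ^ (2 * (CARD('n) - k)) *
     measure (current_measure (current_wedge T (beta_z ^\<^sub>F (CARD('n) - k) \<and>\<^sub>F beta_t ^\<^sub>F CARD('m))))
       (ball 0 r \<times> D)"

definition directional_order :: "nat \<Rightarrow> ('n::finite, 'm::finite) functional \<Rightarrow> (complex^'m) set \<Rightarrow> ereal" where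
  "directional_order k T D = growth_order (directional_nu k T D)"

end

theory Submission
  imports Defs "HOL-Computational_Algebra.Polynomial"
begin

text \<open>
  Expand \<open>\<beta>\<^sub>z = \<Sum> \<theta>\<^sub>j\<close> and \<open>\<beta>\<^sub>t = \<Sum> \<theta>\<^sub>j\<close>, with \<open>\<theta>\<^sub>j = i/(2\<pi>) dx\<^sub>j \<and> d(cnj x\<^sub>j)\<close> and \<open>j\<close> ranging over the
  respective coordinates. Then \<open>(\<beta>\<^sub>z + \<beta>\<^sub>t)\<close> to the power \<open>N - k\<close> is the sum of the wedge products of
  all words of length \<open>N - k\<close> in the \<open>\<theta>\<^sub>j\<close>, and the directional form is the sum over some of these
  words. As \<open>T\<close> is positive, every word gives a positive measure, so that the measure of the
  directional order is dominated by that of the order. For large \<open>r\<close> the set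
  \<open>ball 0 r \<times> D\<close> lies in \<open>ball 0 (2 * r)\<close>; hence \<open>directional_nu k T D r\<close> is at most a constant times
  \<open>r\<close> to the power \<open>2m\<close> times \<open>nu k T (2 * r)\<close>.
\<close>

section \<open>The exterior algebra\<close>

text \<open>The shift \<open>2m\<close> is the gap between the two normalisations,
  \<open>2(N-k) - 2(n-k)\<close>; passing from radius \<open>r\<close> to \<open>2r\<close> costs a
  constant factor and replaces \<open>ln r\<close> by \<open>ln (2 * r)\<close>, neither of which is
  seen by the order. Words are kept ordered and are not collected into multi-indices: each word has
  coefficient one, and the words of the directional form are literally a subset of all words. The
  obstacle is that \<open>current_measure\<close> is a definite description, while positivity speaks
  only of compactly supported (1,0)-forms. With a cutoff, a word yields a measure that represents it
  on a single ball; such measures have to agree on smaller balls and be glued. That a measure is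
  determined by its integrals of smooth functions serves both for gluing and for evaluating the
  definite description, and this is why bump functions are built explicitly. Domination then comes
  from additivity: the measure of all words is the measure of the directional words plus another
  (nonnegative) measure.\<close>

lemma wedge_Nil [simp]: "wedge a b [] = a [] * b []"
  by (simp add: wedge_def)

text \<open>Index sets are sorted by whether they contain 0 and then shifted; this is what peels the
  first vector off a shuffle sum.\<close>

lemma sum_Pow_lessThan_Suc:
  "(\<Sum>S\<in>Pow {..<Suc n}. f S) =
   (\<Sum>S\<in>Pow {..<n}. f (insert 0 (Suc ` S))) + (\<Sum>S\<in>Pow {..<n}. f (Suc ` S))"
proof -
  let ?P = "Pow {..<n}" and ?Q = "Pow (Suc ` {..<n})"
  have Q: "?Q = image Suc ` ?P"
    by (rule image_Pow_surj[OF refl, symmetric])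
  have "Pow {..<Suc n} = ?Q \<union> insert 0 ` ?Q"
    by (simp add: lessThan_Suc_eq_insert_0 Pow_insert)
  moreover have "?Q \<inter> insert 0 ` ?Q = {}"
    by auto
  ultimately have "(\<Sum>S\<in>Pow {..<Suc n}. f S) = sum f ?Q + sum f (insert 0 ` ?Q)"
    by (simp add: sum.union_disjoint)
  moreover have "sum f (insert 0 ` ?Q) = (\<Sum>S\<in>?Q. f (insert 0 S))"
    by (subst sum.reindex) (auto simp: inj_on_def insert_eq_iff subset_iff)
  moreover have "(\<Sum>S\<in>?Q. g S) = (\<Sum>S\<in>?P. g (Suc ` S))" for g :: "nat set \<Rightarrow> 'a"
    unfolding Q by (subst sum.reindex) (auto simp: inj_on_def inj_image_eq_iff)
  ultimately show ?thesis
    by (simp add: add.commute)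
qed

text \<open>The interior product with \<open>v\<close> is an antiderivation. This recursion reduces associativity to
  an induction on the list of arguments, without composing shuffles.\<close>

lemma wedge_Cons:
  "wedge a b (v # vs) = wedge (\<lambda>ws. a (v # ws)) b vs +
     wedge (\<lambda>ws. (-1) ^ length ws * a ws) (\<lambda>ws. b (v # ws)) vs"
proof -
  define inv where "inv S = {(i, j). i \<in> S \<and> j \<notin> S \<and> j < i}" for S :: "nat set"
  let ?shift = "map_prod Suc Suc"
  have card_shift: "card (?shift ` X) = card X" for X :: "(nat \<times> nat) set"
    by (rule card_image) (auto simp: inj_on_def)
  \<comment> \<open>Nothing lies below 0, so putting 0 into the shuffle creates no
    inversion.\<close>
  have ins: "card (inv (insert 0 (Suc ` S))) = card (inv S)" for S
  proof -
    have "inv (insert 0 (Suc ` S)) = ?shift ` inv S"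
    proof (intro set_eqI, clarify)
      fix i j show "(i, j) \<in> inv (insert 0 (Suc ` S)) \<longleftrightarrow> (i, j) \<in> ?shift ` inv S"
        by (cases i; cases j) (auto simp: inv_def image_iff)
    qed
    then show ?thesis by (simp add: card_shift)
  qed
  \<comment> \<open>If 0 goes to the complement, it forms one inversion with each element of the
    shuffle. The resulting sign \<open>(-1) ^ card S\<close> is the factor
    \<open>(-1) ^ length ws\<close> of the antiderivation rule.\<close>
  have suc: "card (inv (Suc ` S)) = card (inv S) + card S" if "finite S" for S
  proof -
    have "finite (inv S)"
      by (rule finite_subset[of _ "S \<times> {..Max S}"])
        (use that in \<open>auto simp: inv_def intro: order.trans[OF less_imp_le Max_ge]\<close>)
    have "inv (Suc ` S) = ?shift ` inv S \<union> (\<lambda>i. (Suc i, 0)) ` S"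
    proof (intro set_eqI, clarify)
      fix i j show "(i, j) \<in> inv (Suc ` S) \<longleftrightarrow>
        (i, j) \<in> ?shift ` inv S \<union> (\<lambda>i. (Suc i, 0)) ` S"
        by (cases i; cases j) (auto simp: inv_def image_iff)
    qed
    moreover have "card (\<dots>) = card (?shift ` inv S) + card ((\<lambda>i. (Suc i, 0::nat)) ` S)"
      by (rule card_Un_disjoint) (use that \<open>finite (inv S)\<close> in auto)
    moreover have "card ((\<lambda>i. (Suc i, 0::nat)) ` S) = card S"
      by (rule card_image) (auto simp: inj_on_def)
    ultimately show ?thesis by (simp add: card_shift)
  qed
  have n1: "nths (v # vs) (insert 0 (Suc ` S)) = v # nths vs S"
    "nths (v # vs) (- insert 0 (Suc ` S)) = nths vs (- S)"
    "nths (v # vs) (Suc ` S) = nths vs S"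
    "nths (v # vs) (- (Suc ` S)) = v # nths vs (- S)" for S
    by (auto simp: nths_Cons image_iff intro!: arg_cong2[where f = nths])
  have len: "length (nths vs S) = card S" if "S \<subseteq> {..<length vs}" for S
    using that by (auto simp: length_nths intro!: arg_cong[where f = card])
  have "wedge a b (v # vs) = (\<Sum>S\<in>Pow {..<Suc (length vs)}.
      (-1) ^ card (inv S) * a (nths (v # vs) S) * b (nths (v # vs) (- S)))"
    by (simp add: wedge_def inv_def)
  also have "\<dots> = (\<Sum>S\<in>Pow {..<length vs}.
        (-1) ^ card (inv S) * a (v # nths vs S) * b (nths vs (- S))) +
      (\<Sum>S\<in>Pow {..<length vs}.
        (-1) ^ card (inv S) * ((-1) ^ length (nths vs S) * a (nths vs S)) * b (v # nths vs (- S)))"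
    unfolding sum_Pow_lessThan_Suc
    by (intro arg_cong2[where f = "(+)"] sum.cong refl)
      (auto simp: n1 ins suc len power_add finite_subset[OF _ finite_lessThan])
  finally show ?thesis
    by (simp add: wedge_def inv_def)
qed

lemma wedge_add_left: "wedge (\<lambda>ws. a ws + a' ws) b vs = wedge a b vs + wedge a' b vs"
  by (simp add: wedge_def algebra_simps sum.distrib)

lemma wedge_add_right: "wedge a (\<lambda>ws. b ws + b' ws) vs = wedge a b vs + wedge a b' vs"
  by (simp add: wedge_def algebra_simps sum.distrib)

lemma wedge_scale_left: "wedge (\<lambda>ws. c * a ws) b vs = c * wedge a b vs"
  by (simp add: wedge_def algebra_simps sum_distrib_left)

lemma wedge_scale_right: "wedge a (\<lambda>ws. c * b ws) vs = c * wedge a b vs"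
  by (simp add: wedge_def algebra_simps sum_distrib_left)

lemma wedge_sum_left: "wedge (\<lambda>ws. \<Sum>i\<in>I. a i ws) b vs = (\<Sum>i\<in>I. wedge (a i) b vs)"
  by (simp add: wedge_def sum_distrib_left sum_distrib_right sum.swap[of _ I])

lemma wedge_sum_right: "wedge a (\<lambda>ws. \<Sum>i\<in>I. b i ws) vs = (\<Sum>i\<in>I. wedge a (b i) vs)"
  by (simp add: wedge_def sum_distrib_left sum_distrib_right sum.swap[of _ I])

text \<open>The grading involution is multiplicative for the wedge product. Associativity needs this
  because the sign in \<open>wedge_Cons\<close> falls on a whole product when the left factor is
  itself a wedge.\<close>

lemma wedge_signed:
  "wedge (\<lambda>ws. (-1) ^ length ws * a ws) (\<lambda>ws. (-1) ^ length ws * b ws) vs =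
   (-1) ^ length vs * wedge a b vs"
proof (induction vs arbitrary: a b)
  case (Cons v vs)
  have s: "wedge (\<lambda>ws. (-1) ^ length ws * ((-1) ^ length ws * a ws)) b' vs' = wedge a b' vs'"
    for a b' :: "'a list \<Rightarrow> complex" and vs'
    by (simp flip: mult.assoc power_mult_distrib)
  show ?case
    using Cons.IH[of "\<lambda>ws. a (v # ws)" b]
      Cons.IH[of "\<lambda>ws. (-1) ^ length ws * a ws" "\<lambda>ws. b (v # ws)"]
    by (simp add: wedge_Cons wedge_scale_left[of "-1", simplified] wedge_scale_right[of _ "-1", simplified]
        wedge_scale_left wedge_scale_right algebra_simps)
qed auto

lemma wedge_assoc: "wedge (wedge a b) c = wedge a (wedge b c)"
proof
  fix vs show "wedge (wedge a b) c vs = wedge a (wedge b c) vs"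
  proof (induction vs arbitrary: a b c)
    case (Cons v vs)
    show ?case
      by (simp add: wedge_Cons wedge_add_left wedge_add_right Cons.IH flip: wedge_signed)
  qed simp
qed

lemma wedge_scalar_right: "wedge a (scalar_form c) vs = c * a vs"
proof (induction vs arbitrary: a)
  case (Cons v vs)
  have "scalar_form c (v # ws) = 0" for ws
    by (simp add: scalar_form_def)
  then show ?case
    by (simp add: wedge_Cons Cons) (simp add: wedge_def)
qed (simp add: scalar_form_def)

lemma wedge_scalar_left: "wedge (scalar_form c) b vs = c * b vs"
proof (induction vs arbitrary: b)
  case (Cons v vs)
  have "scalar_form c (v # ws) = 0" for ws
    by (simp add: scalar_form_def)
  moreover have "(\<lambda>ws :: 'a list. (-1) ^ length ws * scalar_form c ws) = scalar_form c"
    by (auto simp: scalar_form_def)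
  ultimately show ?case
    by (simp add: wedge_Cons Cons) (simp add: wedge_def)
qed (simp add: scalar_form_def)

lemma wedge_zero_left: "wedge (\<lambda>_. 0) b vs = 0"
  by (simp add: wedge_def)

lemma wedge_zero_right: "wedge a (\<lambda>_. 0) vs = 0"
  by (simp add: wedge_def)

lemma wedge_covector:
  "wedge (covector l) (covector m) vs =
     (if length vs = 2 then l (vs ! 0) * m (vs ! 1) - l (vs ! 1) * m (vs ! 0) else 0)"
proof -
  have c: "covector f (v # ws) = scalar_form (f v) ws" for f :: "'a \<Rightarrow> complex" and v ws
    by (simp add: covector_def scalar_form_def)
  have s: "(\<lambda>ws. (-1) ^ length ws * covector l ws) = (\<lambda>ws. - covector l ws)"
    by (auto simp: covector_def)
  have n: "wedge (\<lambda>ws. - covector l ws) (scalar_form d) ws = - d * covector l ws" for d ws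
    using wedge_scale_left[of "-1" "covector l"] by (simp add: wedge_scalar_right)
  show ?thesis
  proof (cases vs)
    case (Cons v ws)
    then show ?thesis
      by (simp add: wedge_Cons c s n wedge_scalar_left)
        (auto simp: covector_def hd_conv_nth length_Suc_conv)
  qed (simp add: covector_def)
qed

lemma wedge_covector_anticommute:
  "wedge (covector l) (covector m) = (\<lambda>vs. - wedge (covector m) (covector l) vs)"
  by (simp add: fun_eq_iff wedge_covector)

section \<open>Forms of bidegree \<open>(p, q)\<close>\<close>

interpretation forms: module "\<lambda>c (a :: 'v list \<Rightarrow> complex) vs. c * a vs"
  by unfold_locales (auto simp: fun_eq_iff algebra_simps)

lemma scale_mem_bidegree: "X \<in> bidegree p q \<Longrightarrow> (\<lambda>vs. c * X vs) \<in> bidegree p q"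
  unfolding bidegree_def by (rule forms.span_scale)

lemma zero_mem_bidegree: "0 \<in> bidegree p q"
  unfolding bidegree_def by (rule forms.span_zero)

lemma sum_mem_bidegree:
  assumes "\<And>i. i \<in> I \<Longrightarrow> X i \<in> bidegree p q"
  shows "(\<lambda>vs. \<Sum>i\<in>I. X i vs) \<in> bidegree p q"
proof -
  have "(\<Sum>i\<in>I. X i) \<in> bidegree p q"
    using assms unfolding bidegree_def by (rule forms.span_sum)
  moreover have "(\<Sum>i\<in>I. X i) = (\<lambda>vs. \<Sum>i\<in>I. X i vs)"
    by (induction I rule: infinite_finite_induct) (auto simp: fun_eq_iff)
  ultimately show ?thesis by simp
qed

text \<open>By linearity in the second factor, it suffices to treat the generators of the
  span.\<close>

lemma wedge_mem_bidegree:
  assumes X: "X \<in> bidegree p q"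
    and gen: "\<And>as bs. set as \<subseteq> covectors10 \<Longrightarrow> length as = p \<Longrightarrow> set bs \<subseteq> covectors01 \<Longrightarrow>
      length bs = q \<Longrightarrow> wedge a (foldr wedge (as @ bs) (scalar_form 1)) \<in> bidegree p' q'"
  shows "wedge a X \<in> bidegree p' q'"
  using X unfolding bidegree_def[of p q]
proof (induction rule: forms.span_induct_alt)
  case base
  have "wedge a 0 = 0"
    by (auto simp: fun_eq_iff wedge_def)
  then show ?case by (simp only: zero_mem_bidegree)
next
  case (step c x y)
  have "wedge a x \<in> bidegree p' q'"
    using step.hyps(1) gen by auto
  then have "(\<lambda>vs. c * wedge a x vs) + wedge a y \<in> bidegree p' q'"
    using step.IH forms.span_scale forms.span_add unfolding bidegree_def by blast
  moreover have "wedge a ((\<lambda>vs. c * x vs) + y) = (\<lambda>vs. c * wedge a x vs) + wedge a y"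
    by (simp add: fun_eq_iff plus_fun_def wedge_add_right wedge_scale_right)
  ultimately show ?case by (simp only:)
qed

lemma wedge_covector10_mem_bidegree:
  assumes "a \<in> covectors10" "X \<in> bidegree p q"
  shows "wedge a X \<in> bidegree (Suc p) q"
  using assms(2)
proof (rule wedge_mem_bidegree)
  fix as bs :: "(('a, 'b) cspace list \<Rightarrow> complex) list"
  assume "set as \<subseteq> covectors10" "length as = p" "set bs \<subseteq> covectors01" "length bs = q"
  then show "wedge a (foldr wedge (as @ bs) (scalar_form 1)) \<in> bidegree (Suc p) q"
    unfolding bidegree_def using assms(1)
    by (intro forms.span_base CollectI exI[of _ "a # as"] exI[of _ bs]) auto
qed

text \<open>Generators of \<open>bidegree\<close> list their (1,0) factors before the (0,1) ones, so
  a (0,1) covector has to be moved past all (1,0) factors, at the price of one sign for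
  each.\<close>

lemma wedge_covector01_foldr:
  assumes "b \<in> covectors01" "set as \<subseteq> covectors10"
  shows "wedge b (foldr wedge as X) = (\<lambda>vs. (-1) ^ length as * foldr wedge as (wedge b X) vs)"
  using assms(2)
proof (induction as)
  case (Cons a as)
  obtain l m where lm: "b = covector l" "a = covector m"
    using assms(1) Cons.prems by (auto simp: covectors01_def covectors10_def)
  have "wedge b (wedge a (foldr wedge as X)) = (\<lambda>vs. - wedge a (wedge b (foldr wedge as X)) vs)"
    using wedge_scale_left[of "-1" "wedge a b"]
    by (simp add: lm wedge_covector_anticommute[of l m] fun_eq_iff flip: wedge_assoc)
  then show ?case
    using Cons by (auto simp: wedge_scale_right)
qed simp

lemma wedge_covector01_mem_bidegree:
  assumes "b \<in> covectors01" "X \<in> bidegree p q"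
  shows "wedge b X \<in> bidegree p (Suc q)"
  using assms(2)
proof (rule wedge_mem_bidegree)
  fix as bs :: "(('a, 'b) cspace list \<Rightarrow> complex) list"
  assume *: "set as \<subseteq> covectors10" "length as = p" "set bs \<subseteq> covectors01" "length bs = q"
  have "foldr wedge (as @ b # bs) (scalar_form 1) \<in> bidegree p (Suc q)"
    unfolding bidegree_def using assms(1) *
    by (intro forms.span_base CollectI exI[of _ as] exI[of _ "b # bs"]) auto
  then show "wedge b (foldr wedge (as @ bs) (scalar_form 1)) \<in> bidegree p (Suc q)"
    using wedge_covector01_foldr[OF assms(1) *(1)] by (simp add: scale_mem_bidegree)
qed

section \<open>Smooth functions\<close>

text \<open>Counting the order of differentiability and differentiating the innermost function first
  lets closure under products, inverses and compositions be proved by induction on the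
  order.\<close>

primrec smooth_upto :: "nat \<Rightarrow> ('a::euclidean_space \<Rightarrow> complex) \<Rightarrow> bool" where
  "smooth_upto 0 f \<longleftrightarrow> True"
| "smooth_upto (Suc n) f \<longleftrightarrow>
     f differentiable_on UNIV \<and> (\<forall>u. smooth_upto n (\<lambda>x. frechet_derivative f (at x) u))"

lemma smooth_upto_SucI:
  assumes "\<And>x. (f has_derivative f' x) (at x)" "\<And>u. smooth_upto n (\<lambda>x. f' x u)"
  shows "smooth_upto (Suc n) f"
proof -
  have "frechet_derivative f (at x) = f' x" for x
    using frechet_derivative_at[OF assms(1)] by simp
  then show ?thesis
    using assms by (auto simp: differentiable_on_def intro: differentiableI)
qed

lemma smooth_upto_SucE:
  assumes "smooth_upto (Suc n) f"
  obtains f' where "\<And>x. (f has_derivative f' x) (at x)" "\<And>u. smooth_upto n (\<lambda>x. f' x u)"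
proof (rule that)
  show "(f has_derivative frechet_derivative f (at x)) (at x)" for x
    using assms by (auto simp: differentiable_on_def frechet_derivative_works)
  show "smooth_upto n (\<lambda>x. frechet_derivative f (at x) u)" for u
    using assms by simp
qed

lemma smooth_upto_mono: "smooth_upto n f \<Longrightarrow> m \<le> n \<Longrightarrow> smooth_upto m f"
proof (induction n arbitrary: m f)
  case (Suc n)
  then show ?case by (cases m) auto
qed simp

lemma iter_deriv_append: "iter_deriv (us @ vs) f = iter_deriv us (iter_deriv vs f)"
  by (induction us) auto

lemma smooth_iff_smooth_upto: "smooth f \<longleftrightarrow> (\<forall>n. smooth_upto n f)"
proof
  assume *: "\<forall>n. smooth_upto n f"
  have "iter_deriv us f differentiable (at x)" if "\<And>n. smooth_upto n f" for us x
    using that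
  \<comment> \<open>\<open>iter_deriv\<close> applies the last direction of the list first, whereas
    \<open>smooth_upto\<close> peels off the first derivative taken; hence induction from the end of
    the list.\<close>
  proof (induction us arbitrary: f rule: rev_induct)
    case Nil
    then have "smooth_upto (Suc 0) f" by blast
    then show ?case by (simp add: differentiable_on_def)
  next
    case (snoc u us)
    have "smooth_upto n (iter_deriv [u] f)" for n
      using snoc.prems[of "Suc n"] by simp
    then show ?case
      using snoc.IH by (simp add: iter_deriv_append)
  qed
  with * show "smooth f" by (simp add: smooth_def)
next
  assume *: "smooth f"
  have "smooth_upto n f" if "smooth f" for n
    using that
  proof (induction n arbitrary: f)
    case (Suc n)
    have "smooth (\<lambda>x. frechet_derivative f (at x) u)" for u
      unfolding smooth_def
    proof (intro allI)
      fix us x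
      have "iter_deriv (us @ [u]) f differentiable at x"
        using Suc.prems unfolding smooth_def by blast
      then show "iter_deriv us (\<lambda>x. frechet_derivative f (at x) u) differentiable at x"
        by (simp add: iter_deriv_append)
    qed
    moreover have "iter_deriv [] f differentiable at x" for x
      using Suc.prems unfolding smooth_def by blast
    ultimately show ?case
      using Suc.IH by (simp add: differentiable_on_def)
  qed simp
  with * show "\<forall>n. smooth_upto n f" by blast
qed

lemma smooth_upto_const: "smooth_upto n (\<lambda>_. c)"
proof (induction n arbitrary: c)
  case (Suc n)
  show ?case
    by (rule smooth_upto_SucI[of _ "\<lambda>_ _. 0"]) (use Suc in auto)
qed simp

lemma smooth_upto_add: "smooth_upto n f \<Longrightarrow> smooth_upto n g \<Longrightarrow> smooth_upto n (\<lambda>x. f x + g x)"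
proof (induction n arbitrary: f g)
  case (Suc n)
  obtain f' where f: "\<And>x. (f has_derivative f' x) (at x)" "\<And>u. smooth_upto n (\<lambda>x. f' x u)"
    using smooth_upto_SucE[OF Suc.prems(1)] by metis
  obtain g' where g: "\<And>x. (g has_derivative g' x) (at x)" "\<And>u. smooth_upto n (\<lambda>x. g' x u)"
    using smooth_upto_SucE[OF Suc.prems(2)] by metis
  show ?case
    by (rule smooth_upto_SucI[of _ "\<lambda>x u. f' x u + g' x u"])
      (auto intro!: Suc.IH f g derivative_intros)
qed simp

lemma smooth_upto_mult: "smooth_upto n f \<Longrightarrow> smooth_upto n g \<Longrightarrow> smooth_upto n (\<lambda>x. f x * g x)"
proof (induction n arbitrary: f g)
  case (Suc n)
  note low = smooth_upto_mono[OF Suc.prems(1), of n] smooth_upto_mono[OF Suc.prems(2), of n]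
  obtain f' where f: "\<And>x. (f has_derivative f' x) (at x)" "\<And>u. smooth_upto n (\<lambda>x. f' x u)"
    using smooth_upto_SucE[OF Suc.prems(1)] by metis
  obtain g' where g: "\<And>x. (g has_derivative g' x) (at x)" "\<And>u. smooth_upto n (\<lambda>x. g' x u)"
    using smooth_upto_SucE[OF Suc.prems(2)] by metis
  show ?case
    by (rule smooth_upto_SucI[of _ "\<lambda>x u. f x * g' x u + f' x u * g x"])
      (auto intro!: Suc.IH smooth_upto_add f g low derivative_intros)
qed simp

text \<open>The derivative of \<open>inverse (f x)\<close> contains the inverse again, but only its
  regularity of one order less is required there, which is the induction hypothesis.\<close>

lemma smooth_upto_inverse:
  "smooth_upto n f \<Longrightarrow> (\<And>x. f x \<noteq> 0) \<Longrightarrow> smooth_upto n (\<lambda>x. inverse (f x))"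
proof (induction n)
  case (Suc n)
  obtain f' where f: "\<And>x. (f has_derivative f' x) (at x)" "\<And>u. smooth_upto n (\<lambda>x. f' x u)"
    using smooth_upto_SucE[OF Suc.prems(1)] by metis
  have inv: "smooth_upto n (\<lambda>x. inverse (f x))"
    by (rule Suc.IH) (use Suc.prems smooth_upto_mono[of "Suc n" f n] in auto)
  show ?case
  proof (rule smooth_upto_SucI)
    show "((\<lambda>x. inverse (f x)) has_derivative (\<lambda>u. - (inverse (f x) * f' x u * inverse (f x)))) (at x)" for x
      by (rule derivative_intros f Suc.prems)+
    show "smooth_upto n (\<lambda>x. - (inverse (f x) * f' x u * inverse (f x)))" for u
      using smooth_upto_mult[OF smooth_upto_const[of n "-1"] smooth_upto_mult[OF smooth_upto_mult[OF inv f(2)] inv]]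
      by simp
  qed
qed simp

lemma smooth_upto_bounded_linear:
  assumes "bounded_linear l"
  shows "smooth_upto n l"
proof (cases n)
  case (Suc m)
  show ?thesis
    unfolding Suc
    by (rule smooth_upto_SucI[of _ "\<lambda>_. l"])
      (use assms in \<open>auto intro: smooth_upto_const bounded_linear_imp_has_derivative\<close>)
qed simp

lemma smooth_const: "smooth (\<lambda>_. c)"
  by (simp add: smooth_iff_smooth_upto smooth_upto_const)

lemma smooth_add: "smooth f \<Longrightarrow> smooth g \<Longrightarrow> smooth (\<lambda>x. f x + g x)"
  by (simp add: smooth_iff_smooth_upto smooth_upto_add)

lemma smooth_mult: "smooth f \<Longrightarrow> smooth g \<Longrightarrow> smooth (\<lambda>x. f x * g x)"
  by (simp add: smooth_iff_smooth_upto smooth_upto_mult)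

lemma smooth_inverse: "smooth f \<Longrightarrow> (\<And>x. f x \<noteq> 0) \<Longrightarrow> smooth (\<lambda>x. inverse (f x))"
  by (simp add: smooth_iff_smooth_upto smooth_upto_inverse)

lemma smooth_diff: "smooth f \<Longrightarrow> smooth g \<Longrightarrow> smooth (\<lambda>x. f x - g x)"
  using smooth_add[of f "\<lambda>x. (-1) * g x"] smooth_mult[OF smooth_const, of g "-1"] by simp

lemma smooth_sum: "(\<And>i. i \<in> I \<Longrightarrow> smooth (f i)) \<Longrightarrow> smooth (\<lambda>x. \<Sum>i\<in>I. f i x)"
  by (induction I rule: infinite_finite_induct) (auto intro: smooth_const smooth_add)

lemma smooth_prod: "(\<And>i. i \<in> I \<Longrightarrow> smooth (f i)) \<Longrightarrow> smooth (\<lambda>x. \<Prod>i\<in>I. f i x)"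
  by (induction I rule: infinite_finite_induct) (auto intro: smooth_const smooth_mult)

lemma smooth_inner: "smooth (\<lambda>x. of_real (x \<bullet> a))"
  by (simp add: smooth_iff_smooth_upto smooth_upto_bounded_linear
      bounded_linear_compose[OF bounded_linear_of_real bounded_linear_inner_left])

lemma smooth_norm_squared: "smooth (\<lambda>x::'a::euclidean_space. of_real ((norm x)\<^sup>2))"
proof -
  have "of_real ((norm x)\<^sup>2) = (\<Sum>b\<in>Basis. of_real (x \<bullet> b) * of_real (x \<bullet> b) :: complex)" for x :: 'a
    by (simp add: power2_norm_eq_inner euclidean_inner[of x x])
  then show ?thesis
    by (simp add: smooth_sum smooth_mult smooth_inner)
qed

lemma smooth_imp_differentiable: "smooth f \<Longrightarrow> f differentiable (at x)"
  unfolding smooth_def by (metis iter_deriv.simps(1))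

lemma smooth_imp_continuous_on: "smooth f \<Longrightarrow> continuous_on S f"
  by (auto intro!: continuous_at_imp_continuous_on differentiable_imp_continuous_within
      smooth_imp_differentiable)

text \<open>The polynomial factor makes this family closed under differentiation.\<close>

definition flat_exp :: "real poly \<Rightarrow> real \<Rightarrow> real" where
  "flat_exp p t = (if t > 0 then poly p (1 / t) * exp (- (1 / t)) else 0)"

lemma tendsto_poly_mult_exp_neg: "((\<lambda>s::real. poly p s * exp (- s)) \<longlongrightarrow> 0) at_top"
proof -
  have "((\<lambda>s. \<Sum>i\<le>degree p. coeff p i * (s ^ i / exp s)) \<longlongrightarrow> (\<Sum>i\<le>degree p. coeff p i * 0)) at_top"
    by (intro tendsto_intros tendsto_power_div_exp_0)
  then show ?thesis
    by (simp add: poly_altdef exp_minus divide_inverse sum_distrib_right mult.assoc)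
qed

text \<open>With \<open>s = 1 / t\<close>, differentiating \<open>p(s) * exp (- s)\<close> in
  \<open>t\<close> gives \<open>s^2 * (p(s) - p'(s)) * exp (- s)\<close>; \<open>monom 1 2\<close>
  is the factor \<open>s^2\<close>. At 0 both one-sided difference quotients tend to 0.\<close>

lemma flat_exp_has_derivative:
  "(flat_exp p has_real_derivative flat_exp (monom 1 2 * (p - pderiv p)) t) (at t)"
proof -
  consider "t > 0" | "t < 0" | "t = 0" by linarith
  then show ?thesis
  proof cases
    case 1
    have "((\<lambda>t. poly p (1 / t) * exp (- (1 / t))) has_real_derivative
        flat_exp (monom 1 2 * (p - pderiv p)) t) (at t)"
      by (rule derivative_eq_intros refl DERIV_chain2[OF poly_DERIV] | use 1 in \<open>simp; fail\<close>)+
        (use 1 in \<open>simp add: flat_exp_def poly_monom field_simps power2_eq_square\<close>)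
    then show ?thesis
      by (rule DERIV_cong_ev[THEN iffD1, OF refl _ refl, rotated])
        (use 1 in \<open>auto simp: flat_exp_def eventually_nhds intro!: exI[of _ "{0<..}"]\<close>)
  next
    case 2
    have "((\<lambda>_. 0) has_real_derivative flat_exp (monom 1 2 * (p - pderiv p)) t) (at t)"
      using 2 by (auto simp: flat_exp_def)
    then show ?thesis
      by (rule DERIV_cong_ev[THEN iffD1, OF refl _ refl, rotated])
        (use 2 in \<open>auto simp: flat_exp_def eventually_nhds intro!: exI[of _ "{..<0}"]\<close>)
  next
    case 3
    have "((\<lambda>h. flat_exp p h / h) \<longlongrightarrow> 0) (at_right 0)"
    proof -
      \<comment> \<open>Division by \<open>h\<close> is multiplication by \<open>s = 1 / h\<close>,
        and \<open>pCons 0 p\<close> is the polynomial \<open>s * p(s)\<close>.\<close>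
      have "((\<lambda>h. poly (pCons 0 p) (inverse h) * exp (- inverse h)) \<longlongrightarrow> 0) (at_right (0::real))"
        by (rule filterlim_compose[OF tendsto_poly_mult_exp_neg filterlim_inverse_at_top_right])
      then show ?thesis
        by (rule Lim_transform_eventually)
          (auto simp: flat_exp_def divide_inverse eventually_at_right_field intro!: exI[of _ 1])
    qed
    moreover have "((\<lambda>h. flat_exp p h / h) \<longlongrightarrow> 0) (at_left 0)"
      by (rule Lim_transform_eventually[OF tendsto_const])
        (auto simp: flat_exp_def eventually_at_left_field intro!: exI[of _ "-1"])
    ultimately have "((\<lambda>h. flat_exp p h / h) \<longlongrightarrow> 0) (at 0)"
      by (simp add: filterlim_split_at)
    then show ?thesis
      using 3 by (simp add: DERIV_def) (simp add: flat_exp_def)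
  qed
qed

lemma smooth_upto_flat_exp:
  assumes "smooth (\<lambda>x. of_real (q x))"
  shows "smooth_upto n (\<lambda>x. of_real (flat_exp p (q x)))"
proof (induction n arbitrary: p)
  case (Suc n)
  let ?q = "\<lambda>x. complex_of_real (q x)"
  let ?p' = "monom 1 2 * (p - pderiv p)"
  obtain q' where q': "\<And>x. (?q has_derivative q' x) (at x)" "\<And>u. smooth_upto n (\<lambda>x. q' x u)"
    using assms smooth_upto_SucE[of n ?q] by (metis smooth_iff_smooth_upto)
  have d: "((\<lambda>x. complex_of_real (flat_exp p (q x))) has_derivative
      (\<lambda>u. of_real (flat_exp ?p' (q x)) * q' x u)) (at x)" for x
  proof -
    have "((\<lambda>x. Re (?q x)) has_derivative (\<lambda>u. Re (q' x u))) (at x)"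
      by (intro derivative_intros q')
    then have re: "(q has_derivative (\<lambda>u. Re (q' x u))) (at x)"
      by simp
    \<comment> \<open>Smoothness is stated for complex-valued functions, the chain rule is applied
      to real ones. The derivative of \<open>q\<close> is real since the imaginary part of
      \<open>?q\<close> is constantly 0.\<close>
    have "((\<lambda>x. Im (?q x)) has_derivative (\<lambda>u. Im (q' x u))) (at x)"
      by (intro derivative_intros q')
    then have "(\<lambda>u. Im (q' x u)) = (\<lambda>_. 0)"
      by (intro has_derivative_unique[of "\<lambda>_. 0"]) auto
    then have "q' x u = of_real (Re (q' x u))" for u
      by (auto simp: complex_eq_iff fun_eq_iff)
    moreover have "((\<lambda>x. flat_exp p (q x)) has_derivative
        (\<lambda>u. flat_exp ?p' (q x) * Re (q' x u))) (at x)"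
      using has_derivative_compose[OF re has_field_derivative_imp_has_derivative[OF flat_exp_has_derivative]]
      by simp
    then have "((\<lambda>x. complex_of_real (flat_exp p (q x))) has_derivative
        (\<lambda>u. of_real (flat_exp ?p' (q x) * Re (q' x u)))) (at x)"
      by (rule has_derivative_of_real)
    ultimately show ?thesis by simp
  qed
  show ?case
    by (rule smooth_upto_SucI[OF d]) (intro smooth_upto_mult Suc q')
qed simp

text \<open>The classical function \<open>exp (- 1 / t)\<close>, extended by 0 to
  \<open>t \<le> 0\<close>.\<close>

definition bump :: "real \<Rightarrow> real" where
  "bump = flat_exp 1"

lemma bump_nonneg [simp]: "bump t \<ge> 0"
  by (simp add: bump_def flat_exp_def)

lemma bump_eq_0_iff [simp]: "bump t = 0 \<longleftrightarrow> t \<le> 0"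
  by (simp add: bump_def flat_exp_def)

lemma smooth_bump: "smooth (\<lambda>x. of_real (q x)) \<Longrightarrow> smooth (\<lambda>x. of_real (bump (q x)))"
  unfolding bump_def by (simp add: smooth_iff_smooth_upto smooth_upto_flat_exp)

text \<open>The quotient \<open>a / (a + b)\<close> works: \<open>a\<close> vanishes exactly where
  the norm is at least \<open>R + 1\<close> and \<open>b\<close> exactly where it is at most
  \<open>R\<close>, so the denominator is positive. Squared norms keep everything smooth at the
  origin.\<close>

lemma smooth_cutoff_exists:
  fixes R :: real
  assumes "R > 0"
  obtains \<kappa> :: "'a::euclidean_space \<Rightarrow> real"
  where "smooth (\<lambda>x. of_real (\<kappa> x))" "\<And>x. x \<in> cball 0 R \<Longrightarrow> \<kappa> x = 1"
    "\<And>x. x \<notin> cball 0 (R + 1) \<Longrightarrow> \<kappa> x = 0"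
proof
  define a where "a x = bump ((R + 1)\<^sup>2 - (norm x)\<^sup>2)" for x :: 'a
  define b where "b x = bump ((norm x)\<^sup>2 - R\<^sup>2)" for x :: 'a
  have a0: "a x = 0 \<longleftrightarrow> R + 1 \<le> norm x" for x
    using assms by (simp add: a_def abs_le_square_iff[symmetric] )
  have b0: "b x = 0 \<longleftrightarrow> norm x \<le> R" for x
    using assms by (simp add: b_def abs_le_square_iff[symmetric])
  have pos: "a x + b x > 0" for x
  proof -
    have "a x \<noteq> 0 \<or> b x \<noteq> 0"
      unfolding a0 b0 by linarith
    moreover have "a x \<ge> 0" "b x \<ge> 0"
      by (auto simp: a_def b_def)
    ultimately show ?thesis by linarith
  qed
  have sm: "smooth (\<lambda>x. of_real (a x))" "smooth (\<lambda>x. of_real (b x))"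
    unfolding a_def b_def
    using smooth_diff[OF smooth_const smooth_norm_squared, of "of_real ((R+1)\<^sup>2)"]
      smooth_diff[OF smooth_norm_squared smooth_const, of "of_real (R\<^sup>2)"]
    by (auto intro!: smooth_bump)
  have "smooth (\<lambda>x. of_real (a x) * inverse (of_real (a x) + of_real (b x)))"
    using pos by (intro smooth_mult smooth_inverse smooth_add sm)
      (metis less_irrefl of_real_add of_real_eq_0_iff)
  then show "smooth (\<lambda>x. of_real (a x / (a x + b x)))"
    by (simp add: divide_inverse)
  show "a x / (a x + b x) = 1" if "x \<in> cball 0 R" for x
    using that b0[of x] pos[of x] by simp
  show "a x / (a x + b x) = 0" if "x \<notin> cball 0 (R + 1)" for x
    using that a0[of x] by simp
qed

section \<open>Radon measures\<close>

definition radon :: "'a::topological_space measure \<Rightarrow> bool" where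
  "radon M \<longleftrightarrow> sets M = sets borel \<and> (\<forall>K. compact K \<longrightarrow> emeasure M K < \<infinity>)"

lemma radonD:
  assumes "radon M"
  shows "sets M = sets borel" "space M = UNIV" "compact K \<Longrightarrow> emeasure M K < \<infinity>"
  using assms sets_eq_imp_space_eq[of M borel] by (auto simp: radon_def)

lemma radon_ball_finite:
  fixes M :: "'a::euclidean_space measure"
  assumes "radon M"
  shows "emeasure M (ball a r) < \<infinity>"
  using emeasure_mono[of "ball a r" "cball a r" M] radonD[OF assms]
  by (auto intro: le_less_trans)

text \<open>Restricting both measures to \<open>B\<close> makes them equal and does not change the
  integral of a function that vanishes off \<open>B\<close>.\<close>

lemma integral_cong_emeasure_on:
  fixes f :: "'a::topological_space \<Rightarrow> complex"
  assumes M: "sets M = sets borel" "sets M' = sets borel" and B: "B \<in> sets borel"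
    and eq: "\<And>A. A \<in> sets borel \<Longrightarrow> A \<subseteq> B \<Longrightarrow> emeasure M A = emeasure M' A"
    and f: "f \<in> borel_measurable borel" "\<And>x. x \<notin> B \<Longrightarrow> f x = 0"
  shows "(LINT x|M. f x) = (LINT x|M'. f x)"
proof -
  have *: "(LINT x|L. f x) = (LINT x|density L (indicator B). f x)" if "sets L = sets borel" for L
  proof -
    have [measurable_cong]: "sets L = sets borel" by fact
    have [measurable]: "B \<in> sets borel" "f \<in> borel_measurable borel" by fact+
    have "(LINT x|density L (\<lambda>x. ennreal (indicator B x)). f x) = (LINT x|L. indicator B x *\<^sub>R f x)"
      by (rule integral_density) auto
    also have "\<dots> = (LINT x|L. f x)"
      by (rule Bochner_Integration.integral_cong) (use f(2) in \<open>auto simp: indicator_def\<close>)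
    finally show ?thesis by (simp add: ennreal_indicator)
  qed
  have "density M (indicator B) = density M' (indicator B)"
    by (rule measure_eqI) (use M B in \<open>auto simp: emeasure_restricted intro!: eq\<close>)
  then show ?thesis
    by (simp add: *[OF M(1)] *[OF M(2)])
qed

text \<open>Indicators of sets \<open>ball 0 R \<inter> box a b\<close> are bounded pointwise limits
  of smooth functions vanishing off the ball, and boxes form a generating system stable under
  intersection.\<close>

lemma measure_eqI_smooth_ball:
  fixes M M' :: "'a::euclidean_space measure"
  assumes M: "radon M" "radon M'" and A: "A \<in> sets borel" "A \<subseteq> ball 0 R"
    and eq: "\<And>f :: 'a \<Rightarrow> real. smooth (\<lambda>x. of_real (f x)) \<Longrightarrow> (\<And>x. x \<notin> ball 0 R \<Longrightarrow> f x = 0) \<Longrightarrow>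
      (LINT x|M. complex_of_real (f x)) = (LINT x|M'. of_real (f x))"
  shows "emeasure M A = emeasure M' A"
proof (cases "R > 0")
  case False
  then have "A = {}" using A by (simp add: ball_empty)
  then show ?thesis by simp
next
  case True
  let ?B = "ball (0 :: 'a) R"
  have box: "emeasure M (?B \<inter> box a b) = emeasure M' (?B \<inter> box a b)" for a b
  proof -
    let ?S = "?B \<inter> box a b"
    \<comment> \<open>A product of bumps that is positive exactly on \<open>?S\<close>; then
      \<open>k f / (1 + k f)\<close> is smooth, lies between 0 and 1, and tends to 1 where
      \<open>f > 0\<close> while staying 0 elsewhere.\<close>
    define f where "f x = bump (R\<^sup>2 - (norm x)\<^sup>2) *
      (\<Prod>i\<in>Basis. bump (x \<bullet> i - a \<bullet> i) * bump (b \<bullet> i - x \<bullet> i))" for x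
    define g where "g k x = real k * f x / (1 + real k * f x)" for k x
    have f_nonneg: "f x \<ge> 0" for x
      by (auto simp: f_def intro!: mult_nonneg_nonneg prod_nonneg)
    have f_eq_0: "f x = 0 \<longleftrightarrow> x \<notin> ?S" for x
      using True abs_le_square_iff[of R "norm x"] by (auto simp: f_def mem_box not_less)
    have nz: "1 + real k * f x > 0" for k x
      using f_nonneg[of x] by (simp add: add_pos_nonneg)
    have "smooth (\<lambda>x. of_real (R\<^sup>2 - (norm x)\<^sup>2))"
      using smooth_diff[OF smooth_const smooth_norm_squared, of "of_real (R\<^sup>2)"] by simp
    moreover have "smooth (\<lambda>x. of_real (x \<bullet> i - a \<bullet> i))" "smooth (\<lambda>x. of_real (b \<bullet> i - x \<bullet> i))" for i
      using smooth_diff[OF smooth_inner smooth_const, of i "of_real (a \<bullet> i)"]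
        smooth_diff[OF smooth_const smooth_inner, of "of_real (b \<bullet> i)" i] by auto
    ultimately have sf: "smooth (\<lambda>x. of_real (f x))"
      unfolding f_def of_real_mult of_real_prod by (intro smooth_mult smooth_prod smooth_bump)
    have sg: "smooth (\<lambda>x. of_real (g k x))" for k
    proof -
      have "smooth (\<lambda>x. of_real (real k) * of_real (f x) * inverse (1 + of_real (real k) * of_real (f x)))"
        by (intro smooth_mult smooth_add smooth_inverse smooth_const sf)
          (metis less_irrefl nz of_real_1 of_real_add of_real_eq_0_iff of_real_mult)
      then show ?thesis by (simp add: g_def divide_inverse)
    qed
    have g_le: "\<bar>g k x\<bar> \<le> indicator ?B x" for k x
      using f_nonneg[of x] f_eq_0[of x] nz[of k x]
      by (cases "x \<in> ?S") (auto simp: g_def divide_le_eq)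
    have g_lim: "(\<lambda>k. g k x) \<longlonglongrightarrow> indicator ?S x" for x
    proof (cases "x \<in> ?S")
      case True
      then have "f x > 0" using f_nonneg[of x] f_eq_0[of x] by linarith
      have "filterlim (\<lambda>k. 1 + f x * real k) at_top sequentially"
        by (rule filterlim_tendsto_add_at_top[OF tendsto_const])
          (rule filterlim_tendsto_pos_mult_at_top[OF tendsto_const \<open>f x > 0\<close> filterlim_real_sequentially])
      then have "(\<lambda>k. 1 - 1 / (1 + real k * f x)) \<longlonglongrightarrow> 1 - 0"
        by (intro tendsto_diff tendsto_const tendsto_divide_0[OF tendsto_const] filterlim_at_top_imp_at_infinity)
          (simp add: mult.commute)
      moreover have "1 - 1 / (1 + real k * f x) = g k x" for k
        using nz[of k x] by (simp add: g_def field_simps)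
      ultimately show ?thesis using True by simp
    qed (use f_eq_0[of x] in \<open>simp add: g_def\<close>)
    have lim: "(\<lambda>k. LINT x|L. complex_of_real (g k x)) \<longlonglongrightarrow> of_real (measure L ?S)"
      and fin: "emeasure L ?S = ennreal (measure L ?S)" if L: "radon L" for L
    proof -
      note [measurable_cong] = radonD(1)[OF L]
      have [measurable]: "(\<lambda>x. complex_of_real (g k x)) \<in> borel_measurable borel" for k
        by (intro borel_measurable_continuous_onI smooth_imp_continuous_on sg)
      have [measurable]: "?S \<in> sets borel" by simp
      have "(\<lambda>x. complex_of_real (indicator ?S x)) \<in> borel_measurable L" by measurable
      then have "(\<lambda>k. LINT x|L. complex_of_real (g k x)) \<longlonglongrightarrow> (LINT x|L. of_real (indicator ?S x))"
        by (rule integral_dominated_convergence[of _ _ _ "indicator ?B :: 'a \<Rightarrow> real"])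
          (use g_le radon_ball_finite[OF L, of 0 R] in
            \<open>auto intro!: tendsto_of_real g_lim simp: integrable_indicator_iff radonD[OF L]\<close>)
      then show "(\<lambda>k. LINT x|L. complex_of_real (g k x)) \<longlonglongrightarrow> of_real (measure L ?S)"
        by (simp add: radonD[OF L])
      have "emeasure L ?S \<le> emeasure L ?B"
        by (rule emeasure_mono) (auto simp: radonD[OF L])
      then show "emeasure L ?S = ennreal (measure L ?S)"
        using radon_ball_finite[OF L, of 0 R] by (intro emeasure_eq_ennreal_measure) auto
    qed
    have same: "(LINT x|M. complex_of_real (g k x)) = (LINT x|M'. of_real (g k x))" for k
      by (rule eq[OF sg]) (use f_eq_0 in \<open>auto simp: g_def\<close>)
    have "complex_of_real (measure M ?S) = of_real (measure M' ?S)"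
      by (rule LIMSEQ_unique[OF lim[OF M(1), unfolded same] lim[OF M(2)]])
    then have "measure M ?S = measure M' ?S"
      by (simp only: of_real_eq_iff)
    then show ?thesis
      by (simp only: fin M)
  qed
  \<comment> \<open>After restriction to the ball both measures are finite, as the uniqueness
    theorem for generators requires on an exhausting sequence of boxes.\<close>
  have "density M (indicator ?B) = density M' (indicator ?B)"
  proof (rule measure_eqI_generator_eq[where E = "range (\<lambda>(a, b). box a b)" and \<Omega> = UNIV
        and A = "\<lambda>n::nat. box (- (real n *\<^sub>R One)) (real n *\<^sub>R One)"])
    show "Int_stable (range (\<lambda>(a, b). box a b :: 'a set))"
      by (auto simp: Int_stable_def box_Int_box)
    show "emeasure (density M (indicator ?B)) X = emeasure (density M' (indicator ?B)) X"
      if "X \<in> range (\<lambda>(a, b). box a b)" for X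
      using that box by (auto simp: emeasure_restricted radonD M)
    show "emeasure (density M (indicator ?B)) (box (- (real n *\<^sub>R One)) (real n *\<^sub>R One)) \<noteq> \<infinity>" for n
    proof -
      have "emeasure M (?B \<inter> box (- (real n *\<^sub>R One)) (real n *\<^sub>R One)) \<le> emeasure M ?B"
        by (rule emeasure_mono) (auto simp: radonD M)
      then show ?thesis
        using radon_ball_finite[OF M(1), of 0 R]
        by (subst emeasure_restricted) (auto simp: radonD M)
    qed
    show "(\<Union>n::nat. box (- (real n *\<^sub>R One)) (real n *\<^sub>R One)) = (UNIV :: 'a set)"
      by (rule UN_box_eq_UNIV)
  qed (auto simp: radonD M borel_eq_box)
  then have "emeasure (density M (indicator ?B)) A = emeasure (density M' (indicator ?B)) A"
    by simp
  moreover have "?B \<inter> A = A" using A by auto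
  ultimately show ?thesis
    using A by (simp add: emeasure_restricted radonD M)
qed

text \<open>\<open>M\<close> is known only through its values on sets, so additivity is carried from
  indicators to nonnegative functions by the standard induction; in the limit step, suprema of
  increasing sequences add.\<close>

lemma nn_integral_sum_measure:
  assumes M: "sets M1 = sets M" "sets M2 = sets M"
    and add: "\<And>A. A \<in> sets M \<Longrightarrow> emeasure M A = emeasure M1 A + emeasure M2 A"
    and f: "f \<in> borel_measurable M"
  shows "(\<integral>\<^sup>+x. f x \<partial>M) = (\<integral>\<^sup>+x. f x \<partial>M1) + (\<integral>\<^sup>+x. f x \<partial>M2)"
proof -
  have [simp]: "space M1 = space M" "space M2 = space M"
    using M sets_eq_imp_space_eq by blast+
  note [measurable_cong] = M
  show ?thesis
    using f
  proof (induction f)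
    case (cong f g)
    then show ?case
      by (metis (no_types, lifting) \<open>space M1 = space M\<close> \<open>space M2 = space M\<close> nn_integral_cong)
  next
    case (set A)
    then show ?case by (simp add: M add)
  next
    case (mult u c)
    then have [measurable]: "u \<in> borel_measurable M" by simp
    show ?case
      using mult by (simp add: nn_integral_cmult distrib_left)
  next
    case (add u v)
    then have [measurable]: "u \<in> borel_measurable M" "v \<in> borel_measurable M" by auto
    show ?case
      using add by (simp add: nn_integral_add algebra_simps)
  next
    case (seq U)
    note [measurable] = \<open>\<And>i. U i \<in> borel_measurable M\<close>
    have *: "(\<integral>\<^sup>+x. (SUP i. U i) x \<partial>L) = (SUP i. \<integral>\<^sup>+x. U i x \<partial>L)"
      if [measurable_cong]: "sets L = sets M" for L
      unfolding SUP_apply by (rule nn_integral_monotone_convergence_SUP)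
        (auto intro!: monoI le_funI le_funD[OF incseqD[OF \<open>incseq U\<close>]])
    have mono: "incseq (\<lambda>i. \<integral>\<^sup>+x. U i x \<partial>L)" for L
      using \<open>incseq U\<close> by (auto simp: incseq_def le_fun_def intro!: nn_integral_mono)
    show ?case
      unfolding *[OF refl] *[OF M(1)] *[OF M(2)] seq.IH by (rule ennreal_SUP_add[OF mono mono])
  qed
qed

lemma integral_sum_measure:
  fixes f :: "'a \<Rightarrow> complex"
  assumes M: "sets M1 = sets M" "sets M2 = sets M"
    and add: "\<And>A. A \<in> sets M \<Longrightarrow> emeasure M A = emeasure M1 A + emeasure M2 A"
    and f: "integrable M1 f" "integrable M2 f"
  shows "(LINT x|M. f x) = (LINT x|M1. f x) + (LINT x|M2. f x)"
proof -
  note nn = nn_integral_sum_measure[OF M add]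
  have meas: "f \<in> borel_measurable M"
    using borel_measurable_integrable[OF f(1)] M by (simp cong: measurable_cong_sets)
  then have "integrable M f"
    using f by (simp add: integrable_iff_bounded nn)
  have real: "(LINT x|M. g x) = (LINT x|M1. g x) + (LINT x|M2. g x)"
    if "integrable M g" "integrable M1 g" "integrable M2 g" for g :: "'a \<Rightarrow> real"
  proof -
    note [measurable] = borel_measurable_integrable[OF that(1)]
    have fin: "(\<integral>\<^sup>+x. ennreal (g x) \<partial>L) < top" "(\<integral>\<^sup>+x. ennreal (- g x) \<partial>L) < top"
      if "integrable L g" for L
      using that unfolding real_integrable_def by (auto simp: top.not_eq_extremum)
    show ?thesis
      using fin that by (simp add: real_lebesgue_integral_def nn enn2real_plus)
  qed
  show ?thesis
    using f \<open>integrable M f\<close> real[of "\<lambda>x. Re (f x)"] real[of "\<lambda>x. Im (f x)"]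
    by (simp add: complex_eq_iff)
qed

lemma sum_measure_exists:
  fixes M1 M2 :: "'a measure"
  assumes "sets M1 = sets M2"
  obtains M where "sets M = sets M1"
    "\<And>A. A \<in> sets M1 \<Longrightarrow> emeasure M A = emeasure M1 A + emeasure M2 A"
proof
  define M where "M = measure_of (space M1) (sets M1) (\<lambda>A. emeasure M1 A + emeasure M2 A)"
  show "sets M = sets M1"
    by (simp add: M_def)
  show "emeasure M A = emeasure M1 A + emeasure M2 A" if "A \<in> sets M1" for A
    unfolding M_def
  proof (rule emeasure_measure_of_sigma)
    show "countably_additive (sets M1) (\<lambda>A. emeasure M1 A + emeasure M2 A)"
      using assms by (auto simp: countably_additive_def suminf_emeasure suminf_add[symmetric])
  qed (use that in \<open>auto simp: positive_def intro: sets.sigma_algebra_axioms\<close>)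
qed

section \<open>Functionals represented by measures: uniqueness, sums and gluing\<close>

text \<open>The local form of \<open>represented_by\<close>: a cutoff equals 1 only on a ball, so
  positivity yields a measure that is correct only for test functions vanishing off that
  ball.\<close>

definition represented_on :: "real \<Rightarrow> ('n::finite, 'm::finite) functional \<Rightarrow> ('n, 'm) cspace measure \<Rightarrow> bool" where
  "represented_on R S M \<longleftrightarrow> radon M \<and>
     (\<forall>\<phi>\<in>test_forms 0 0. (\<forall>x. x \<notin> ball 0 R \<longrightarrow> \<phi> x = 0) \<longrightarrow> S \<phi> = (LINT x|M. \<phi> x []))"

lemma represented_by_iff:
  "represented_by S M \<longleftrightarrow> radon M \<and> (\<forall>\<phi>\<in>test_forms 0 0. S \<phi> = (LINT x|M. \<phi> x []))"
  by (auto simp: represented_by_def radon_def)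

lemma represented_on_mono: "represented_on R' S M \<Longrightarrow> R \<le> R' \<Longrightarrow> represented_on R S M"
  unfolding represented_on_def by (meson subset_ball subset_iff)

lemma represented_by_imp_represented_on: "represented_by S M \<Longrightarrow> represented_on R S M"
  by (auto simp: represented_by_iff represented_on_def)

lemma compact_fsupport:
  assumes "\<And>x. x \<notin> ball 0 R \<Longrightarrow> \<omega> x = 0"
  shows "compact (fsupport \<omega>)"
proof -
  have "fsupport \<omega> \<subseteq> cball 0 R"
    unfolding fsupport_def using assms by (intro closure_minimal) (force simp: less_imp_le)+
  then show ?thesis
    by (simp add: fsupport_def compact_eq_bounded_closed bounded_subset[OF bounded_cball])
qed

lemma mem_bidegree_0_0: "a \<in> bidegree 0 0 \<longleftrightarrow> a = scalar_form (a [])"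
proof
  assume "a \<in> bidegree 0 0"
  then have "\<forall>vs. vs \<noteq> [] \<longrightarrow> a vs = 0"
    unfolding bidegree_def
    by (induction rule: forms.span_induct_alt) (auto simp: scalar_form_def)
  then show "a = scalar_form (a [])"
    by (simp add: fun_eq_iff scalar_form_def)
next
  assume "a = scalar_form (a [])"
  then have "a = (\<lambda>vs. a [] * scalar_form 1 vs)"
    by (metis (full_types) ext mult.right_neutral mult_zero_right scalar_form_def)
  moreover have "scalar_form 1 \<in> bidegree 0 0"
    unfolding bidegree_def by (rule forms.span_base) auto
  ultimately show "a \<in> bidegree 0 0"
    by (metis scale_mem_bidegree)
qed

lemma func_form_mem_test_forms:
  assumes "smooth f" "\<And>x. x \<notin> ball 0 R \<Longrightarrow> f x = 0"
  shows "func_form f \<in> test_forms 0 0"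
proof -
  have "smooth (\<lambda>x. scalar_form (f x) vs)" for vs :: "('a, 'b) cspace list"
    by (cases vs) (auto simp: scalar_form_def assms(1) smooth_const)
  moreover have "compact (fsupport (func_form f))"
    by (rule compact_fsupport[of R]) (auto simp: func_form_def assms(2) scalar_form_def)
  ultimately show ?thesis
    by (auto simp: test_forms_def func_form_def mem_bidegree_0_0 scalar_form_def)
qed

text \<open>The radii \<open>Suc n\<close> are positive, as the cutoff construction demands, and run
  through the balls used for gluing; the added 1 places a closed ball inside an open one.\<close>

lemma test_forms_vanish_outside_ball:
  assumes "\<phi> \<in> test_forms p q"
  obtains n where "\<And>x. x \<notin> ball 0 (real (Suc n)) \<Longrightarrow> \<phi> x = 0"
proof -
  have "bounded (fsupport \<phi>)"
    using assms by (simp add: test_forms_def compact_imp_bounded)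
  then obtain r where "\<forall>x\<in>fsupport \<phi>. norm x \<le> r"
    unfolding bounded_iff by blast
  moreover obtain n where "r \<le> real n"
    using real_arch_simple by blast
  ultimately have "\<phi> x = 0" if "x \<notin> ball 0 (real (Suc n))" for x
    using that closure_subset[of "{x. \<phi> x \<noteq> 0}"] by (force simp: fsupport_def)
  then show ?thesis by (rule that)
qed

lemma test_forms_coeff_borel:
  "\<phi> \<in> test_forms p q \<Longrightarrow> (\<lambda>x. \<phi> x vs) \<in> borel_measurable borel"
  by (intro borel_measurable_continuous_onI smooth_imp_continuous_on) (auto simp: test_forms_def)

lemma test_forms_coeff_integrable:
  assumes \<phi>: "\<phi> \<in> test_forms p q" and M: "radon M"
  shows "integrable M (\<lambda>x. \<phi> x vs)"
proof -
  note [measurable_cong] = radonD(1)[OF M]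
  obtain n where n: "\<And>x. x \<notin> ball 0 (real (Suc n)) \<Longrightarrow> \<phi> x = 0"
    using test_forms_vanish_outside_ball[OF \<phi>] by blast
  let ?K = "cball 0 (real (Suc n))"
  have "compact ((\<lambda>x. \<phi> x vs) ` ?K)"
    using \<phi> by (intro compact_continuous_image smooth_imp_continuous_on) (auto simp: test_forms_def)
  then have "bounded ((\<lambda>x. \<phi> x vs) ` ?K)"
    by (rule compact_imp_bounded)
  then obtain C where C: "\<And>x. x \<in> ?K \<Longrightarrow> norm (\<phi> x vs) \<le> C"
    unfolding bounded_iff by (metis imageI)
  have "integrable M (\<lambda>x. indicator ?K x *\<^sub>R C)"
    using radonD(3)[OF M, of ?K] by (auto simp: integrable_indicator_iff radonD[OF M])
  then show ?thesis
  proof (rule Bochner_Integration.integrable_bound)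
    have "norm (\<phi> x vs) \<le> norm (indicator ?K x *\<^sub>R C)" for x
      using C[of x] n[of x] by (cases "x \<in> ?K") (auto simp: indicator_def)
    then show "AE x in M. norm (\<phi> x vs) \<le> norm (indicator ?K x *\<^sub>R C)" by simp
  qed (use test_forms_coeff_borel[OF \<phi>] in simp)
qed

lemma represented_on_unique:
  assumes "represented_on R S M" "represented_on R S M'" "A \<in> sets borel" "A \<subseteq> ball 0 R"
  shows "emeasure M A = emeasure M' A"
proof (rule measure_eqI_smooth_ball[OF _ _ assms(3,4)])
  fix f :: "('a, 'b) cspace \<Rightarrow> real"
  assume *: "smooth (\<lambda>x. of_real (f x))" "\<And>x. x \<notin> ball 0 R \<Longrightarrow> f x = 0"
  let ?\<phi> = "func_form (\<lambda>x. of_real (f x))"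
  have "?\<phi> \<in> test_forms 0 0" "\<forall>x. x \<notin> ball 0 R \<longrightarrow> ?\<phi> x = 0"
    using * by (auto intro!: func_form_mem_test_forms[of _ R]) (auto simp: func_form_def scalar_form_def)
  then have "S ?\<phi> = (LINT x|M. ?\<phi> x [])" "S ?\<phi> = (LINT x|M'. ?\<phi> x [])"
    using assms(1,2) unfolding represented_on_def by blast+
  then show "(LINT x|M. complex_of_real (f x)) = (LINT x|M'. of_real (f x))"
    by (simp add: func_form_def scalar_form_def)
qed (use assms in \<open>auto simp: represented_on_def\<close>)

text \<open>Local uniqueness on balls, followed by exhaustion. This gives the definite description
  in \<open>current_measure\<close> its value.\<close>

lemma represented_by_unique:
  assumes M: "represented_by S M" and M': "represented_by S M'"
  shows "M = M'"
proof (rule measure_eqI)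
  have sets: "sets M = sets borel" "sets M' = sets borel"
    using assms by (auto simp: represented_by_def)
  then show "sets M = sets M'" by simp
  fix A assume A: "A \<in> sets M"
  have U: "(\<Union>n. A \<inter> ball 0 (real n)) = A"
    by (auto simp: reals_Archimedean2)
  have *: "emeasure L A = (SUP n. emeasure L (A \<inter> ball 0 (real n)))" if "sets L = sets borel" for L
    by (subst SUP_emeasure_incseq) (use that A sets U in \<open>force simp: incseq_def\<close>)+
  have "emeasure M (A \<inter> ball 0 (real n)) = emeasure M' (A \<inter> ball 0 (real n))" for n
    by (rule represented_on_unique[of "real n" S])
      (use assms A sets in \<open>auto intro: represented_by_imp_represented_on\<close>)
  then show "emeasure M A = emeasure M' A"
    by (simp add: * sets)
qed

lemma current_measure_eq: "represented_by S M \<Longrightarrow> current_measure S = M"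
  unfolding current_measure_def by (rule the_equality) (auto intro: represented_by_unique)

lemma represented_by_add:
  assumes "represented_by S1 M1" "represented_by S2 M2"
  obtains M where "represented_by (\<lambda>\<phi>. S1 \<phi> + S2 \<phi>) M"
    "\<And>A. A \<in> sets borel \<Longrightarrow> emeasure M A = emeasure M1 A + emeasure M2 A"
proof -
  have r: "radon M1" "radon M2"
    using assms by (auto simp: represented_by_iff)
  obtain M where M: "sets M = sets M1"
    "\<And>A. A \<in> sets M1 \<Longrightarrow> emeasure M A = emeasure M1 A + emeasure M2 A"
    using sum_measure_exists[of M1 M2] r by (auto simp: radonD)
  have "emeasure M K < \<infinity>" if "compact K" for K
    using M(2)[of K] radonD(3)[OF r(1) that] radonD(3)[OF r(2) that] that r
    by (simp add: radonD borel_compact)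
  then have "radon M"
    using M(1) r by (simp add: radon_def)
  moreover have "S1 \<phi> + S2 \<phi> = (LINT x|M. \<phi> x [])" if "\<phi> \<in> test_forms 0 0" for \<phi>
    using integral_sum_measure[of M1 M M2 "\<lambda>x. \<phi> x []"] M r assms that
    by (auto simp: represented_by_iff radonD test_forms_coeff_integrable)
  ultimately have "represented_by (\<lambda>\<phi>. S1 \<phi> + S2 \<phi>) M"
    by (simp add: represented_by_iff)
  then show ?thesis
    using M r by (intro that) (auto simp: radonD)
qed

text \<open>By local uniqueness the restrictions \<open>N n\<close> of the local measures to their
  balls increase, and their supremum agrees with \<open>L n\<close> on the ball of radius
  \<open>Suc n\<close>. Every test function lives in one such ball.\<close>

lemma represented_by_glue:
  fixes S :: "('n::finite, 'm::finite) functional"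
  assumes "\<And>n :: nat. \<exists>M. represented_on (real (Suc n)) S M"
  obtains M where "represented_by S M"
proof -
  obtain L where L: "\<And>n :: nat. represented_on (real (Suc n)) S (L n)"
    using assms by metis
  then have r: "radon (L n)" for n
    by (auto simp: represented_on_def)
  let ?B = "\<lambda>n. ball (0 :: ('n, 'm) cspace) (real (Suc n))"
  define N where "N n = density (L n) (indicator (?B n))" for n
  have sets_N: "sets (N n) = sets borel" for n
    by (simp add: N_def radonD[OF r])
  have N: "emeasure (N n) A = emeasure (L n) (?B n \<inter> A)" if "A \<in> sets borel" for n A
    using that by (simp add: N_def emeasure_restricted radonD[OF r])
  have agree: "emeasure (L n) A = emeasure (L k) A" if "n \<le> k" "A \<in> sets borel" "A \<subseteq> ?B n" for n k A
    by (rule represented_on_unique[OF L[of n] represented_on_mono[OF L[of k]]]) (use that in auto)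
  have mono: "N n \<le> N k" if "n \<le> k" for n k
  proof -
    have "emeasure (N n) A \<le> emeasure (N k) A" for A
    proof (cases "A \<in> sets borel")
      case True
      have "emeasure (L k) (?B n \<inter> A) \<le> emeasure (L k) (?B k \<inter> A)"
        using True that by (intro emeasure_mono) (auto simp: radonD[OF r])
      then show ?thesis
        using True agree[OF that, of "?B n \<inter> A"] by (simp add: N)
    qed (simp add: emeasure_notin_sets sets_N)
    then show ?thesis
      using sets_eq_imp_space_eq[of "N n" "N k"] by (simp add: le_measure_iff sets_N le_fun_def)
  qed
  define M where "M = (SUP n. N n)"
  have sets_M: "sets M = sets borel"
    unfolding M_def by (rule sets_SUP) (auto simp: sets_N)
  \<comment> \<open>For a chain, the supremum in the lattice of measures is computed set by
    set.\<close>
  have chain: "Complete_Partial_Order.chain (\<le>) (range N)"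
    using mono by (auto simp: Complete_Partial_Order.chain_def) (metis nle_le)
  have M: "emeasure M A = emeasure (L n) A" if A: "A \<in> sets borel" "A \<subseteq> ?B n" for n A
  proof -
    have "emeasure (N k) A \<le> emeasure (L n) A" for k
    proof (cases "k \<le> n")
      case True
      have "emeasure (L n) (?B k \<inter> A) \<le> emeasure (L n) A"
        using A by (intro emeasure_mono) (auto simp: radonD[OF r])
      then show ?thesis
        using A agree[OF True, of "?B k \<inter> A"] by (simp add: N)
    next
      case False
      then have "?B k \<inter> A = A"
        using A(2) subset_ball[of "real (Suc n)" "real (Suc k)"] by auto
      then show ?thesis
        using A False agree[of n k A] by (simp add: N)
    qed
    moreover have "emeasure (N n) A = emeasure (L n) A"
      using A by (simp add: N Int_absorb1)
    ultimately have "(SUP k. emeasure (N k) A) = emeasure (L n) A"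
      by (intro antisym SUP_least SUP_upper2[of n]) auto
    then show ?thesis
      unfolding M_def by (subst emeasure_SUP_chain[OF _ _ chain, of borel]) (use A in \<open>auto simp: sets_N\<close>)
  qed
  have "radon M"
    unfolding radon_def
  proof (intro conjI allI impI sets_M)
    fix K :: "('n, 'm) cspace set" assume K: "compact K"
    then have "bounded K"
      by (rule compact_imp_bounded)
    then obtain b where "\<And>x. x \<in> K \<Longrightarrow> norm x \<le> b"
      unfolding bounded_iff by blast
    moreover obtain n where "b \<le> real n"
      using real_arch_simple by blast
    ultimately have "K \<subseteq> ?B n" by force
    then show "emeasure M K < \<infinity>"
      using M[of K n] K radonD(3)[OF r K] by (simp add: borel_compact)
  qed
  moreover have "S \<phi> = (LINT x|M. \<phi> x [])" if \<phi>: "\<phi> \<in> test_forms 0 0" for \<phi>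
  proof -
    obtain n where n: "\<And>x. x \<notin> ?B n \<Longrightarrow> \<phi> x = 0"
      using test_forms_vanish_outside_ball[OF \<phi>] by blast
    have "S \<phi> = (LINT x|L n. \<phi> x [])"
      using L[of n] n \<phi> by (auto simp: represented_on_def)
    also have "\<dots> = (LINT x|M. \<phi> x [])"
      by (rule integral_cong_emeasure_on[of _ _ "?B n"])
        (use n M in \<open>auto simp: radonD[OF r] sets_M test_forms_coeff_borel[OF \<phi>]\<close>)
    finally show ?thesis .
  qed
  ultimately have "represented_by S M"
    by (simp add: represented_by_iff)
  then show ?thesis by (rule that)
qed

section \<open>The standard forms\<close>

definition coord :: "'n + 'm \<Rightarrow> ('n::finite, 'm::finite) cspace \<Rightarrow> complex" where
  "coord j x = (case j of Inl i \<Rightarrow> fst x $ i | Inr i \<Rightarrow> snd x $ i)"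

lemma bounded_linear_coord: "bounded_linear (coord j)"
proof (cases j)
  case (Inl i)
  have "bounded_linear (\<lambda>x :: ('a, 'b) cspace. fst x $ i)"
    by (rule bounded_linear_compose[OF bounded_linear_vec_nth bounded_linear_fst])
  then show ?thesis by (simp add: Inl coord_def[abs_def])
next
  case (Inr i)
  have "bounded_linear (\<lambda>x :: ('a, 'b) cspace. snd x $ i)"
    by (rule bounded_linear_compose[OF bounded_linear_vec_nth bounded_linear_snd])
  then show ?thesis by (simp add: Inr coord_def[abs_def])
qed

lemma coord_imul [simp]: "coord j (imul v) = \<i> * coord j v"
  by (cases j) (auto simp: coord_def imul_def)

lemma coord_has_derivative: "(coord j has_derivative coord j) (at x)"
  by (rule bounded_linear_imp_has_derivative[OF bounded_linear_coord])

lemma cnj_coord_has_derivative: "((\<lambda>x. cnj (coord j x)) has_derivative (\<lambda>v. cnj (coord j v))) (at x)"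
  by (rule has_derivative_cnj[OF coord_has_derivative])

text \<open>Positivity is tested on factors of the exact shape
  \<open>i \<alpha> \<and> cnj \<alpha>\<close>; dividing each covector by
  \<open>sqrt (2 * pi)\<close> absorbs the constant \<open>1 / (2 * pi)\<close> of
  \<open>theta\<close>.\<close>

definition norm_coord :: "'n + 'm \<Rightarrow> ('n::finite, 'm::finite) cspace \<Rightarrow> complex" where
  "norm_coord j v = coord j v / of_real (sqrt (2 * pi))"

definition theta :: "'n + 'm \<Rightarrow> ('n::finite, 'm::finite) cspace list \<Rightarrow> complex" where
  "theta j = (\<lambda>vs. \<i> * wedge (covector (norm_coord j)) (covector (\<lambda>v. cnj (norm_coord j v))) vs)"

definition theta_word :: "('n + 'm) list \<Rightarrow> ('n::finite, 'm::finite) cspace list \<Rightarrow> complex" where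
  "theta_word J = foldr wedge (map theta J) (scalar_form 1)"

lemma linear_norm_coord: "linear (norm_coord j)"
proof -
  have "linear (\<lambda>v. coord j v / of_real (sqrt (2 * pi)))"
    by (rule bounded_linear.linear[OF bounded_linear_divide[THEN bounded_linear_compose, OF bounded_linear_coord]])
  then show ?thesis by (simp add: norm_coord_def[abs_def])
qed

lemma norm_coord_covectors10: "covector (norm_coord j) \<in> covectors10"
  unfolding covectors10_def by (intro CollectI exI[of _ "norm_coord j"])
    (auto simp: linear_norm_coord norm_coord_def)

lemma norm_coord_covectors01: "covector (\<lambda>v. cnj (norm_coord j v)) \<in> covectors01"
proof -
  have "linear (\<lambda>v. cnj (norm_coord j v))"
    using linear_compose[OF linear_norm_coord bounded_linear.linear[OF bounded_linear_cnj]]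
    by (simp add: comp_def)
  then show ?thesis
    unfolding covectors01_def by (intro CollectI exI[of _ "\<lambda>v. cnj (norm_coord j v)"])
      (auto simp: norm_coord_def)
qed

lemma theta_word_mem_bidegree: "theta_word J \<in> bidegree (length J) (length J)"
proof (induction J)
  case Nil
  show ?case
    by (simp add: theta_word_def mem_bidegree_0_0) (simp add: scalar_form_def fun_eq_iff)
next
  case (Cons j J)
  have "theta_word (j # J) = (\<lambda>vs. \<i> * wedge (covector (norm_coord j))
      (wedge (covector (\<lambda>v. cnj (norm_coord j v))) (theta_word J)) vs)"
    by (simp add: theta_word_def theta_def fun_eq_iff wedge_scale_left wedge_assoc)
  then show ?case
    using Cons by (simp add: scale_mem_bidegree wedge_covector10_mem_bidegree
        wedge_covector01_mem_bidegree norm_coord_covectors10 norm_coord_covectors01)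
qed

lemma length_nths_delete: "i < length vs \<Longrightarrow> length (nths vs (- {i})) = length vs - 1"
proof -
  assume i: "i < length vs"
  have "{j. j < length vs \<and> j \<in> - {i}} = {..<length vs} - {i}" by auto
  then show ?thesis using i by (simp add: length_nths)
qed

text \<open>The terms with \<open>imul\<close> in \<open>deriv10\<close> and \<open>deriv01\<close>
  cancel, which leaves the real differential.\<close>

lemma ext_d_eq:
  "ext_d \<omega> x vs = (\<Sum>i<length vs. (-1) ^ i *
     frechet_derivative (\<lambda>y. \<omega> y (nths vs (- {i}))) (at x) (vs ! i))"
  by (simp add: ext_d_def del_def delbar_def deriv10_def deriv01_def field_simps
      flip: sum.distrib)

lemma ext_dc_func_form:
  "ext_dc (func_form f) x vs =
     (if length vs = 1 then \<i> / (4 * of_real pi) * (deriv01 f x (vs ! 0) - deriv10 f x (vs ! 0)) else 0)"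
proof (cases "length vs = 1")
  case True
  then obtain v where "vs = [v]" by (auto simp: length_Suc_conv)
  then show ?thesis
    by (simp add: ext_dc_def fscale_def del_def delbar_def func_form_def scalar_form_def)
next
  case False
  have "func_form f y (nths vs (- {i})) = 0" if "i < length vs" for i y
    using length_nths_delete[OF that] that False by (auto simp: func_form_def scalar_form_def)
  then have "deriv01 (\<lambda>y. func_form f y (nths vs (- {i}))) x v = 0"
    "deriv10 (\<lambda>y. func_form f y (nths vs (- {i}))) x v = 0" if "i < length vs" for i v
    using that by (simp_all add: deriv01_def deriv10_def)
  then show ?thesis
    using False by (auto simp: ext_dc_def fscale_def del_def delbar_def)
qed

lemma theta_pair:
  "theta j vs = (if length vs = 2 then \<i> / (2 * of_real pi) *
     (coord j (vs ! 0) * cnj (coord j (vs ! 1)) - coord j (vs ! 1) * cnj (coord j (vs ! 0))) else 0)"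
proof -
  have "complex_of_real (sqrt (2 * pi)) * of_real (sqrt (2 * pi)) = 2 * of_real pi"
    by (simp only: of_real_mult[symmetric] real_sqrt_mult_self) simp
  then show ?thesis
    by (simp add: theta_def wedge_covector norm_coord_def diff_divide_distrib[symmetric])
qed

text \<open>Stated for any set of coordinates, so that \<open>beta_z\<close> and
  \<open>beta_t\<close> are the cases \<open>range Inl\<close> and \<open>range Inr\<close>.\<close>

lemma ddc_sum_norm_squares:
  fixes I :: "('n::finite + 'm::finite) set"
  shows "ext_d (ext_dc (func_form (\<lambda>x. \<Sum>j\<in>I. coord j x * cnj (coord j x)))) =
    (\<lambda>x vs. \<Sum>j\<in>I. theta j vs)"
proof (intro ext)
  fix x :: "('n, 'm) cspace" and vs
  let ?f = "\<lambda>x :: ('n, 'm) cspace. \<Sum>j\<in>I. coord j x * cnj (coord j x)"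
  \<comment> \<open>\<open>g w y\<close> is the value of the one-form
    \<open>ext_dc (func_form ?f)\<close> at the point \<open>y\<close> on the vector
    \<open>w\<close>. It is real linear in \<open>y\<close>, hence its own derivative;
    antisymmetrising doubles it and turns \<open>4 * pi\<close> into \<open>2 * pi\<close>.\<close>
  define g where "g w y = \<i> / (4 * of_real pi) *
    (\<Sum>j\<in>I. coord j y * cnj (coord j w) - cnj (coord j y) * coord j w)" for w y :: "('n, 'm) cspace"
  have "(?f has_derivative (\<lambda>v. \<Sum>j\<in>I. coord j y * cnj (coord j v) + coord j v * cnj (coord j y))) (at y)" for y
    by (intro has_derivative_sum has_derivative_mult coord_has_derivative cnj_coord_has_derivative)
  then have D: "frechet_derivative ?f (at y) =
      (\<lambda>v. \<Sum>j\<in>I. coord j y * cnj (coord j v) + coord j v * cnj (coord j y))" for y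
    by (rule frechet_derivative_at[symmetric])
  have f10: "deriv10 ?f y v = (\<Sum>j\<in>I. cnj (coord j y) * coord j v)" for y v
    unfolding deriv10_def D
    by (simp add: sum_distrib_left sum_subtractf[symmetric] sum_divide_distrib)
      (intro sum.cong refl, simp add: algebra_simps)
  have f01: "deriv01 ?f y v = (\<Sum>j\<in>I. coord j y * cnj (coord j v))" for y v
    unfolding deriv01_def D
    by (simp add: sum_distrib_left sum.distrib[symmetric] sum_divide_distrib)
      (intro sum.cong refl, simp add: algebra_simps)
  have dc: "ext_dc (func_form ?f) y ws = (if length ws = 1 then g (ws ! 0) y else 0)" for y ws
    by (simp add: ext_dc_func_form f10 f01 g_def sum_subtractf)
  have "(g w has_derivative g w) (at y)" for w y
    unfolding g_def
    by (intro has_derivative_mult_right has_derivative_sum has_derivative_diff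
        has_derivative_mult_left coord_has_derivative cnj_coord_has_derivative)
  then have Dg: "frechet_derivative (g w) (at y) = g w" for w y
    by (rule frechet_derivative_at[symmetric])
  show "ext_d (ext_dc (func_form ?f)) x vs = (\<Sum>j\<in>I. theta j vs)"
  proof (cases "length vs = 2")
    case True
    then obtain v w where vs: "vs = [v, w]" by (auto simp: length_Suc_conv numeral_2_eq_2)
    have "ext_d (ext_dc (func_form ?f)) x vs = g w v - g v w"
      by (simp add: ext_d_eq vs lessThan_Suc nths_Cons dc Dg)
    also have "\<dots> = (\<Sum>j\<in>I. theta j vs)"
      by (simp add: g_def theta_pair vs sum_distrib_left sum_subtractf[symmetric])
        (intro sum.cong refl, simp add: field_simps)
    finally show ?thesis .
  next
    case False
    then have "length vs - Suc 0 \<noteq> Suc 0" by linarith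
    with False show ?thesis
      by (auto simp: ext_d_eq dc theta_pair length_nths_delete intro!: sum.neutral)
  qed
qed

lemma of_real_norm_vec_squared:
  fixes z :: "complex ^ 'k::finite"
  shows "complex_of_real ((norm z)\<^sup>2) = (\<Sum>i\<in>UNIV. z $ i * cnj (z $ i))"
proof -
  have "(norm z)\<^sup>2 = (\<Sum>i\<in>UNIV. (norm (z $ i))\<^sup>2)"
    by (simp add: norm_vec_def L2_set_def sum_nonneg)
  then show ?thesis
    by (simp add: complex_norm_square[symmetric] del: of_real_power)
qed

lemma beta_z_eq: "beta_z = (\<lambda>x vs. \<Sum>j\<in>range Inl. theta j vs)"
proof -
  have "(\<lambda>(z, t). complex_of_real ((norm z)\<^sup>2)) =
      (\<lambda>x :: ('a, 'b) cspace. \<Sum>j\<in>range Inl. coord j x * cnj (coord j x))"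
    by (simp only: of_real_norm_vec_squared case_prod_unfold sum.reindex[OF inj_Inl] comp_def)
      (simp add: coord_def)
  then show ?thesis
    by (simp only: beta_z_def ddc_sum_norm_squares)
qed

lemma beta_t_eq: "beta_t = (\<lambda>x vs. \<Sum>j\<in>range Inr. theta j vs)"
proof -
  have "(\<lambda>(z, t). complex_of_real ((norm t)\<^sup>2)) =
      (\<lambda>x :: ('a, 'b) cspace. \<Sum>j\<in>range Inr. coord j x * cnj (coord j x))"
    by (simp only: of_real_norm_vec_squared case_prod_unfold sum.reindex[OF inj_Inr] comp_def)
      (simp add: coord_def)
  then show ?thesis
    by (simp only: beta_t_def ddc_sum_norm_squares)
qed

lemma beta_eq: "beta_z + beta_t = (\<lambda>x vs. \<Sum>j\<in>UNIV. theta j vs)"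
proof -
  have "(\<Sum>j\<in>UNIV. theta j vs) = (\<Sum>j\<in>range Inl. theta j vs) + (\<Sum>j\<in>range Inr. theta j vs)"
    for vs :: "('a, 'b) cspace list"
    unfolding UNIV_sum by (rule sum.union_disjoint) auto
  then show ?thesis
    by (simp add: beta_z_eq beta_t_eq fun_eq_iff)
qed

section \<open>Powers of the standard forms as sums over words\<close>

lemma fwedge_list_apply: "fwedge_list \<omega>s x = foldr wedge (map (\<lambda>\<omega>. \<omega> x) \<omega>s) (scalar_form 1)"
  unfolding fwedge_list_def
  by (induction \<omega>s) (simp_all add: func_form_def fwedge_def)

lemma finite_listset: "(\<And>A. A \<in> set As \<Longrightarrow> finite A) \<Longrightarrow> finite (listset As)"
proof (induction As)
  case (Cons A As)
  have "listset (A # As) = (\<lambda>(x, xs). x # xs) ` (A \<times> listset As)"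
    by (auto simp: set_Cons_def)
  then show ?case using Cons by simp
qed simp

lemma length_listset: "J \<in> listset As \<Longrightarrow> length J = length As"
  by (induction As arbitrary: J) (auto simp: set_Cons_def)

lemma mem_listset_replicate_UNIV: "J \<in> listset (replicate (length J) UNIV)"
  by (induction J) (auto simp: set_Cons_def)

text \<open>Multilinearity of the wedge product: \<open>listset As\<close> consists of the words
  whose letters are chosen one from each set, in order, so each word occurs with coefficient
  one.\<close>

lemma foldr_wedge_sums:
  fixes As :: "('n::finite + 'm::finite) set list"
  shows "foldr wedge (map (\<lambda>A vs. \<Sum>j\<in>A. theta j vs) As) (scalar_form 1) =
    (\<lambda>vs. \<Sum>J\<in>listset As. theta_word J vs)"
proof (induction As)
  case Nil
  then show ?case by (simp add: theta_word_def)
next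
  case (Cons A As)
  have ls: "listset (A # As) = (\<lambda>(x, xs). x # xs) ` (A \<times> listset As)"
    by (auto simp: set_Cons_def)
  have "(\<Sum>J\<in>listset (A # As). theta_word J vs) =
      (\<Sum>j\<in>A. \<Sum>J\<in>listset As. wedge (theta j) (theta_word J) vs)" for vs
    unfolding ls sum.cartesian_product
    by (subst sum.reindex) (auto simp: inj_on_def theta_word_def intro: sum.cong)
  then show ?case
    by (simp add: Cons wedge_sum_left wedge_sum_right fun_eq_iff)
qed

lemma foldr_wedge_append:
  "foldr wedge (as @ bs) (scalar_form 1) =
   wedge (foldr wedge as (scalar_form 1)) (foldr wedge bs (scalar_form 1))"
proof (induction as)
  case Nil
  show ?case by (simp add: fun_eq_iff wedge_scalar_left)
next
  case (Cons a as)
  then show ?case by (simp add: wedge_assoc)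
qed

lemma beta_power: "(beta_z + beta_t) ^\<^sub>F p = (\<lambda>x vs. \<Sum>J\<in>listset (replicate p UNIV). theta_word J vs)"
  by (rule ext) (simp add: fwedge_list_apply beta_eq foldr_wedge_sums[symmetric])

lemma beta_z_beta_t_power:
  "beta_z ^\<^sub>F a \<and>\<^sub>F beta_t ^\<^sub>F b =
   (\<lambda>x vs. \<Sum>J\<in>listset (replicate a (range Inl) @ replicate b (range Inr)). theta_word J vs)"
  by (rule ext) (simp add: fwedge_def fwedge_list_apply beta_z_eq beta_t_eq
      foldr_wedge_append foldr_wedge_sums[symmetric] del: foldr_append)

section \<open>Growth order\<close>

text \<open>Taking logarithms, \<open>ln (f r)\<close> is at most
  \<open>ln C + q * ln r + ln (g (2 * r))\<close>; after division by \<open>ln r\<close> the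
  constant vanishes and \<open>ln (2 * r) / ln r\<close> tends to 1.\<close>

lemma growth_order_le:
  fixes f g :: "real \<Rightarrow> real" and C :: real and q :: nat
  assumes f: "\<And>r. f r \<ge> 0" and g: "\<And>r. g r \<ge> 0" and C: "C > 0"
    and le: "eventually (\<lambda>r. f r \<le> C * r ^ q * g (2 * r)) at_top"
    and fin: "growth_order g < \<infinity>"
  shows "growth_order f \<le> ereal (real q) + growth_order g"
proof -
  \<comment> \<open>A real \<open>c\<close> strictly above the order gives a genuine inequality for
    all large \<open>r\<close>, and covers finite order and order minus infinity at once.\<close>
  have bound: "growth_order f \<le> ereal (real q + c)" if c: "growth_order g < ereal c" for c
  proof -
    define h where "h r = (ln C + real q * ln r + c * ln (2 * r)) / ln r" for r
    have "(h \<longlongrightarrow> 0 + real q + c * (0 + 1)) at_top"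
    proof -
      have inv: "((\<lambda>r::real. a / ln r) \<longlongrightarrow> 0) at_top" for a
        by (rule tendsto_divide_0[OF tendsto_const filterlim_at_top_imp_at_infinity[OF ln_at_top]])
      have "((\<lambda>r. ln C / ln r + real q + c * (ln 2 / ln r + 1)) \<longlongrightarrow> 0 + real q + c * (0 + 1)) at_top"
        by (intro tendsto_intros inv)
      moreover have "eventually (\<lambda>r. ln C / ln r + real q + c * (ln 2 / ln r + 1) = h r) at_top"
        using eventually_gt_at_top[of 1]
        by eventually_elim (simp add: h_def ln_mult field_simps)
      ultimately show ?thesis
        by (rule Lim_transform_eventually)
    qed
    then have lim: "((\<lambda>r. ereal (h r)) \<longlongrightarrow> ereal (real q + c)) at_top"
      by simp
    have "eventually (\<lambda>r. elog (g r) / ereal (ln r) < ereal c) at_top"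
      using c unfolding growth_order_def by (rule Limsup_lessD)
    moreover have "filterlim (\<lambda>r::real. 2 * r) at_top at_top"
      by (rule filterlim_tendsto_pos_mult_at_top[OF tendsto_const _ filterlim_ident]) simp
    ultimately have g_ev: "eventually (\<lambda>r. elog (g (2 * r)) / ereal (ln (2 * r)) < ereal c) at_top"
      by (rule eventually_compose_filterlim)
    have "eventually (\<lambda>r. elog (f r) / ereal (ln r) \<le> ereal (h r)) at_top"
      using le g_ev eventually_gt_at_top[of 1]
    proof eventually_elim
      case (elim r)
      show ?case
      proof (cases "f r = 0")
        case True
        \<comment> \<open>Here \<open>elog\<close> is minus infinity and \<open>ln r > 0\<close>, so
          the quotient is minus infinity.\<close>
        then show ?thesis using elim by (simp add: elog_def)
      next
        case False
        then have "f r > 0" using f[of r] by simp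
        with elim(1) have "0 < C * r ^ q * g (2 * r)" by linarith
        then have gpos: "g (2 * r) > 0"
          using zero_less_mult_pos[of "C * r ^ q" "g (2 * r)"] C elim(3) by simp
        have "ln (f r) \<le> ln (C * r ^ q * g (2 * r))"
          using \<open>f r > 0\<close> elim(1) by simp
        also have "\<dots> = ln C + real q * ln r + ln (g (2 * r))"
          using C elim(3) gpos by (simp add: ln_mult ln_realpow)
        also have "ln (g (2 * r)) \<le> c * ln (2 * r)"
          using elim(2,3) gpos by (simp add: elog_def divide_less_eq)
        finally have "ln (f r) \<le> ln C + real q * ln r + c * ln (2 * r)" by simp
        then show ?thesis
          using False elim(3) by (simp add: elog_def h_def divide_right_mono)
      qed
    qed
    then have "growth_order f \<le> Limsup at_top (\<lambda>r. ereal (h r))"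
      unfolding growth_order_def by (rule Limsup_mono)
    also have "\<dots> = ereal (real q + c)"
      by (rule lim_imp_Limsup[OF _ lim]) simp
    finally show ?thesis .
  qed
  show ?thesis
  proof (cases "growth_order g")
    case (real \<rho>)
    have "growth_order f \<le> ereal (real q + \<rho>) + ereal e" if "e > 0" for e
      using bound[of "\<rho> + e"] that real by (simp add: add.assoc)
    then show ?thesis
      using real by (simp add: ereal_le_epsilon2)
  next
    case PInf
    then show ?thesis using fin by simp
  next
    case MInf
    have "growth_order f \<le> ereal b" for b
      using bound[of "b - real q"] MInf by simp
    then have "growth_order f = - \<infinity>"
      by (rule ereal_bot)
    then show ?thesis by simp
  qed
qed

section \<open>Currents\<close>

lemma wedge_test_form_0_0:
  assumes "\<phi> \<in> test_forms 0 0"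
  shows "wedge w (\<phi> x) = (\<lambda>vs. \<phi> x [] * w vs)"
proof -
  have "\<phi> x \<in> bidegree 0 0"
    using assms unfolding test_forms_def by blast
  then have "\<phi> x = scalar_form (\<phi> x [])"
    by (simp only: mem_bidegree_0_0)
  then have "wedge w (\<phi> x) = wedge w (scalar_form (\<phi> x []))" by simp
  then show ?thesis by (simp add: fun_eq_iff wedge_scalar_right)
qed

lemma const_fwedge_test_form:
  assumes w: "w \<in> bidegree p p" and \<phi>: "\<phi> \<in> test_forms 0 0"
  shows "(\<lambda>_. w) \<and>\<^sub>F \<phi> \<in> test_forms p p"
proof -
  obtain n where n: "\<And>x. x \<notin> ball 0 (real (Suc n)) \<Longrightarrow> \<phi> x = 0"
    using test_forms_vanish_outside_ball[OF \<phi>] by blast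
  have eq: "(\<lambda>_. w) \<and>\<^sub>F \<phi> = (\<lambda>x vs. \<phi> x [] * w vs)"
    by (simp add: fwedge_def wedge_test_form_0_0[OF \<phi>])
  have "compact (fsupport ((\<lambda>_. w) \<and>\<^sub>F \<phi>))"
    by (rule compact_fsupport[of "real (Suc n)"]) (simp add: eq n fun_eq_iff)
  then show ?thesis
    using \<phi> by (auto simp: test_forms_def eq intro!: scale_mem_bidegree w smooth_mult smooth_const)
qed

text \<open>A current is additive only on test forms of its bidegree; the membership lemmas for
  \<open>bidegree\<close> exist to justify this step.\<close>

lemma current_wedge_const_add:
  fixes T :: "('n::finite, 'm::finite) functional"
  assumes T: "current k T"
    and w: "w1 \<in> bidegree (CARD('n) + CARD('m) - k) (CARD('n) + CARD('m) - k)"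
      "w2 \<in> bidegree (CARD('n) + CARD('m) - k) (CARD('n) + CARD('m) - k)"
    and \<phi>: "\<phi> \<in> test_forms 0 0"
  shows "current_wedge T (\<lambda>x vs. w1 vs + w2 vs) \<phi> =
    current_wedge T (\<lambda>_. w1) \<phi> + current_wedge T (\<lambda>_. w2) \<phi>"
proof -
  have "(\<lambda>x vs. w1 vs + w2 vs) \<and>\<^sub>F \<phi> = ((\<lambda>_. w1) \<and>\<^sub>F \<phi>) + ((\<lambda>_. w2) \<and>\<^sub>F \<phi>)"
    by (simp add: fun_eq_iff fwedge_def wedge_add_left)
  then show ?thesis
    using T const_fwedge_test_form[OF w(1) \<phi>] const_fwedge_test_form[OF w(2) \<phi>]
    by (simp add: current_wedge_def current_def Let_def)
qed

lemma current_zero: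
  fixes T :: "('n::finite, 'm::finite) functional"
  assumes "current k T"
  shows "T (\<lambda>_ _. 0) = 0"
proof -
  let ?p = "CARD('n) + CARD('m) - k"
  have "compact (fsupport (\<lambda>_ _. 0 :: complex) :: ('n, 'm) cspace set)"
    by (simp add: fsupport_def zero_fun_def)
  then have "(\<lambda>_ _. 0) \<in> (test_forms ?p ?p :: ('n, 'm) dform set)"
    using zero_mem_bidegree by (auto simp: test_forms_def smooth_const zero_fun_def)
  then have "T (fscale 0 (\<lambda>_ _. 0)) = 0 * T (\<lambda>_ _. 0)"
    using assms unfolding current_def Let_def by blast
  then show ?thesis by (simp add: fscale_def)
qed

text \<open>Positivity is only assumed for compactly supported forms, so that the constant forms
  are multiplied by a cutoff function first.\<close>

lemma theta_word_represented_on: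
  fixes T :: "('n::finite, 'm::finite) functional"
  assumes T: "positive_current k T" and J: "length J = CARD('n) + CARD('m) - k" and R: "R > 0"
  shows "\<exists>M. represented_on R (current_wedge T (\<lambda>_. theta_word J)) M"
proof -
  obtain \<kappa> :: "('n, 'm) cspace \<Rightarrow> real" where \<kappa>: "smooth (\<lambda>x. of_real (\<kappa> x))"
    "\<And>x. x \<in> cball 0 R \<Longrightarrow> \<kappa> x = 1" "\<And>x. x \<notin> cball 0 (R + 1) \<Longrightarrow> \<kappa> x = 0"
    using smooth_cutoff_exists[OF R] by blast
  \<comment> \<open>Each letter contributes the cutoff twice, through \<open>\<alpha> j\<close> and
    its conjugate, so the word acquires the factor \<open>\<kappa>\<close> to the power
    \<open>2 * length J\<close>. It is 1 on \<open>ball 0 R\<close>, and elsewhere the test function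
    is 0.\<close>
  define \<alpha> :: "'n + 'm \<Rightarrow> ('n, 'm) dform"
    where "\<alpha> j = (\<lambda>x vs. of_real (\<kappa> x) * covector (norm_coord j) vs)" for j
  have "\<alpha> j \<in> test_forms 1 0" for j
  proof -
    have "wedge (covector (norm_coord j)) (scalar_form 1) \<in>
        (bidegree 1 0 :: (('n, 'm) cspace list \<Rightarrow> complex) set)"
      using wedge_covector10_mem_bidegree[OF norm_coord_covectors10, of "scalar_form 1" 0 0]
      by (simp add: mem_bidegree_0_0) (simp add: scalar_form_def fun_eq_iff)
    then have "covector (norm_coord j) \<in> (bidegree 1 0 :: (('n, 'm) cspace list \<Rightarrow> complex) set)"
      by (simp add: wedge_scalar_right[abs_def])
    moreover have "compact (fsupport (\<alpha> j))"
      by (rule compact_fsupport[of "R + 2"]) (auto simp: \<alpha>_def fun_eq_iff \<kappa>(3))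
    ultimately show ?thesis
      by (auto simp: test_forms_def \<alpha>_def intro!: scale_mem_bidegree smooth_mult smooth_const \<kappa>)
  qed
  then have "set (map \<alpha> J) \<subseteq> test_forms 1 0 \<and> length (map \<alpha> J) = CARD('n) + CARD('m) - k"
    using J by auto
  then have "is_positive_measure (current_wedge T
      (fwedge_list (map (\<lambda>\<alpha>. fscale \<i> (\<alpha> \<and>\<^sub>F fcnj \<alpha>)) (map \<alpha> J))))"
    using T unfolding positive_current_def by blast
  then obtain M where M: "represented_by (current_wedge T
      (fwedge_list (map (\<lambda>\<alpha>. fscale \<i> (\<alpha> \<and>\<^sub>F fcnj \<alpha>)) (map \<alpha> J)))) M"
    unfolding is_positive_measure_def by blast
  have fac: "fscale \<i> (\<alpha> j \<and>\<^sub>F fcnj (\<alpha> j)) x = (\<lambda>vs. of_real ((\<kappa> x)\<^sup>2) * theta j vs)" for j x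
  proof -
    have conj: "fcnj (\<alpha> j) x = (\<lambda>vs. of_real (\<kappa> x) * covector (\<lambda>v. cnj (norm_coord j v)) vs)"
      by (auto simp: fcnj_def \<alpha>_def covector_def fun_eq_iff)
    have "wedge (\<alpha> j x) (fcnj (\<alpha> j) x) vs = of_real (\<kappa> x) * (of_real (\<kappa> x) *
        wedge (covector (norm_coord j)) (covector (\<lambda>v. cnj (norm_coord j v))) vs)" for vs
      unfolding conj unfolding \<alpha>_def by (simp only: wedge_scale_left wedge_scale_right)
    then show ?thesis
      by (simp add: fscale_def fwedge_def theta_def fun_eq_iff power2_eq_square)
  qed
  have word: "fwedge_list (map (\<lambda>\<alpha>. fscale \<i> (\<alpha> \<and>\<^sub>F fcnj \<alpha>)) (map \<alpha> J)) x =
      (\<lambda>vs. of_real ((\<kappa> x)\<^sup>2) ^ length J * theta_word J vs)" for x and J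
    unfolding fwedge_list_apply theta_word_def
  proof (induction J)
    case (Cons j J)
    show ?case
      by (rule ext) (use Cons in \<open>simp add: fac wedge_scale_left wedge_scale_right del: of_real_power\<close>)
  qed simp
  have "fwedge_list (map (\<lambda>\<alpha>. fscale \<i> (\<alpha> \<and>\<^sub>F fcnj \<alpha>)) (map \<alpha> J)) \<and>\<^sub>F \<phi> = (\<lambda>_. theta_word J) \<and>\<^sub>F \<phi>"
    if "\<forall>x. x \<notin> ball 0 R \<longrightarrow> \<phi> x = 0" for \<phi>
  proof
    fix x show "(fwedge_list (map (\<lambda>\<alpha>. fscale \<i> (\<alpha> \<and>\<^sub>F fcnj \<alpha>)) (map \<alpha> J)) \<and>\<^sub>F \<phi>) x =
      ((\<lambda>_. theta_word J) \<and>\<^sub>F \<phi>) x"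
    proof (cases "x \<in> ball 0 R")
      case True
      then have "\<kappa> x = 1" by (intro \<kappa>(2)) simp
      then show ?thesis unfolding fwedge_def[of _ \<phi>] word by simp
    next
      case False
      then have "\<phi> x = 0"
        using that by blast
      then have zero: "\<phi> x = (\<lambda>_. 0)"
        by (simp add: zero_fun_def)
      show ?thesis
        unfolding fwedge_def[of _ \<phi>] zero by (simp add: fun_eq_iff wedge_zero_right)
    qed
  qed
  then have "represented_on R (current_wedge T (\<lambda>_. theta_word J)) M"
    using represented_by_imp_represented_on[OF M, of R] by (simp add: represented_on_def current_wedge_def)
  then show ?thesis ..
qed

lemma theta_word_represented:
  fixes T :: "('n::finite, 'm::finite) functional"
  assumes "positive_current k T" "length J = CARD('n) + CARD('m) - k"
  obtains M where "represented_by (current_wedge T (\<lambda>_. theta_word J)) M"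
proof (rule represented_by_glue)
  fix n show "\<exists>M. represented_on (real (Suc n)) (current_wedge T (\<lambda>_. theta_word J)) M"
    by (rule theta_word_represented_on[OF assms]) simp
qed

lemma represented_by_cong:
  assumes "\<And>\<phi>. \<phi> \<in> test_forms 0 0 \<Longrightarrow> S \<phi> = S' \<phi>"
  shows "represented_by S M \<longleftrightarrow> represented_by S' M"
  using assms by (simp add: represented_by_iff)

lemma sum_theta_words_mem_bidegree:
  assumes "\<And>J. J \<in> \<J> \<Longrightarrow> length J = p"
  shows "(\<lambda>vs. \<Sum>J\<in>\<J>. theta_word J vs) \<in> bidegree p p"
proof (rule sum_mem_bidegree)
  show "theta_word J \<in> bidegree p p" if "J \<in> \<J>" for J
    using theta_word_mem_bidegree[of J] assms[OF that] by simp
qed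

lemma theta_words_represented:
  fixes T :: "('n::finite, 'm::finite) functional"
  assumes T: "positive_current k T" and "finite \<J>"
    and "\<And>J. J \<in> \<J> \<Longrightarrow> length J = CARD('n) + CARD('m) - k"
  shows "\<exists>M. represented_by (current_wedge T (\<lambda>_ vs. \<Sum>J\<in>\<J>. theta_word J vs)) M"
  using assms(2,3)
proof (induction \<J>)
  case empty
  have "current k T"
    using T by (simp add: positive_current_def)
  then have "T (\<lambda>_ _. 0) = 0"
    by (rule current_zero)
  then have "current_wedge T (\<lambda>_ _. 0) \<phi> = 0" for \<phi>
    by (simp add: current_wedge_def fwedge_def wedge_zero_left[abs_def])
  then have "represented_by (current_wedge T (\<lambda>_ _. 0)) (null_measure borel)"
    by (simp add: represented_by_iff radon_def)
  then show ?case by auto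
next
  case (insert J \<J>)
  let ?p = "CARD('n) + CARD('m) - k"
  obtain M1 where M1: "represented_by (current_wedge T (\<lambda>_. theta_word J)) M1"
    using theta_word_represented[OF T] insert.prems by blast
  obtain M2 where M2: "represented_by (current_wedge T (\<lambda>_ vs. \<Sum>J\<in>\<J>. theta_word J vs)) M2"
    using insert by auto
  have "(\<lambda>vs :: ('n, 'm) cspace list. \<Sum>J\<in>\<J>. theta_word J vs) \<in> bidegree ?p ?p"
    by (rule sum_theta_words_mem_bidegree) (use insert.prems in blast)
  moreover have "(theta_word J :: ('n, 'm) cspace list \<Rightarrow> complex) \<in> bidegree ?p ?p"
    using theta_word_mem_bidegree[of J] insert.prems[of J] by simp
  ultimately have "represented_by (current_wedge T (\<lambda>_ vs. \<Sum>J\<in>insert J \<J>. theta_word J vs)) M \<longleftrightarrow>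
      represented_by (\<lambda>\<phi>. current_wedge T (\<lambda>_. theta_word J) \<phi> +
        current_wedge T (\<lambda>_ vs. \<Sum>J\<in>\<J>. theta_word J vs) \<phi>) M" for M
    using T insert.hyps
    by (intro represented_by_cong) (simp add: current_wedge_const_add[where k = k] positive_current_def)
  moreover obtain M where "represented_by (\<lambda>\<phi>. current_wedge T (\<lambda>_. theta_word J) \<phi> +
        current_wedge T (\<lambda>_ vs. \<Sum>J\<in>\<J>. theta_word J vs) \<phi>) M"
    using represented_by_add[OF M1 M2] by blast
  ultimately show ?case by blast
qed

text \<open>The words in \<open>\<J>' - \<J>\<close> are represented by a measure as well, so the
  larger measure is the smaller one plus a nonnegative remainder.\<close>

lemma current_measure_theta_words_mono:
  fixes T :: "('n::finite, 'm::finite) functional"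
  assumes T: "positive_current k T" and fin: "finite \<J>'" and sub: "\<J> \<subseteq> \<J>'"
    and len: "\<And>J. J \<in> \<J>' \<Longrightarrow> length J = CARD('n) + CARD('m) - k"
    and A: "A \<in> sets borel"
  shows "emeasure (current_measure (current_wedge T (\<lambda>_ vs. \<Sum>J\<in>\<J>. theta_word J vs))) A \<le>
    emeasure (current_measure (current_wedge T (\<lambda>_ vs. \<Sum>J\<in>\<J>'. theta_word J vs))) A"
proof -
  let ?p = "CARD('n) + CARD('m) - k"
  let ?S = "\<lambda>\<J>. current_wedge T (\<lambda>_ vs. \<Sum>J\<in>\<J>. theta_word J vs)"
  have fin': "finite \<J>" "finite (\<J>' - \<J>)"
    using fin sub by (auto intro: finite_subset)
  have len': "\<And>J. J \<in> \<J> \<Longrightarrow> length J = ?p" "\<And>J. J \<in> \<J>' - \<J> \<Longrightarrow> length J = ?p"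
    using len sub by auto
  obtain M1 where M1: "represented_by (?S \<J>) M1"
    using theta_words_represented[OF T fin'(1) len'(1)] by blast
  obtain M2 where M2: "represented_by (?S (\<J>' - \<J>)) M2"
    using theta_words_represented[OF T fin'(2) len'(2)] by blast
  obtain M where M: "represented_by (\<lambda>\<phi>. ?S \<J> \<phi> + ?S (\<J>' - \<J>) \<phi>) M"
    "\<And>A. A \<in> sets borel \<Longrightarrow> emeasure M A = emeasure M1 A + emeasure M2 A"
    using represented_by_add[OF M1 M2] by blast
  have "(\<lambda>vs :: ('n, 'm) cspace list. \<Sum>J\<in>\<J>. theta_word J vs) \<in> bidegree ?p ?p"
    by (rule sum_theta_words_mem_bidegree) (rule len'(1))
  moreover have "(\<lambda>vs :: ('n, 'm) cspace list. \<Sum>J\<in>\<J>' - \<J>. theta_word J vs) \<in> bidegree ?p ?p"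
    by (rule sum_theta_words_mem_bidegree) (rule len'(2))
  moreover have "(\<Sum>J\<in>\<J>'. theta_word J vs) =
      (\<Sum>J\<in>\<J>. theta_word J vs) + (\<Sum>J\<in>\<J>' - \<J>. theta_word J vs)" for vs :: "('n, 'm) cspace list"
    using sum.subset_diff[OF sub fin] by (simp add: add.commute)
  ultimately have "represented_by (?S \<J>') M \<longleftrightarrow> represented_by (\<lambda>\<phi>. ?S \<J> \<phi> + ?S (\<J>' - \<J>) \<phi>) M"
    using T by (intro represented_by_cong) (simp add: current_wedge_const_add[where k = k] positive_current_def)
  with M(1) have "represented_by (?S \<J>') M" by blast
  then show ?thesis
    using M(2)[OF A] M1 by (simp add: current_measure_eq)
qed

theorem proposition1:
  fixes T :: "('n::finite, 'm::finite) functional"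
    and D :: "(complex^'m) set"
    and k :: nat
  assumes "k < CARD('n)"
    and "positive_current k T"
    and "plurisubharmonic k T"
    and "D \<in> sets borel"
    and "compact (closure D)"
    and "current_order k T < \<infinity>"
  shows "directional_order k T D < \<infinity> \<and>
    directional_order k T D \<le> ereal (2 * real CARD('m)) + current_order k T"
proof -
  let ?n = "CARD('n)" and ?m = "CARD('m)"
  let ?p = "?n + ?m - k"
  define \<J> where "\<J> = listset (replicate (?n - k) (range Inl) @ replicate ?m (range Inr) :: ('n + 'm) set list)"
  define \<J>' where "\<J>' = listset (replicate ?p UNIV :: ('n + 'm) set list)"
  let ?M = "\<lambda>\<J>. current_measure (current_wedge T (\<lambda>_ vs. \<Sum>J\<in>\<J>. theta_word J vs))"
  \<comment> \<open>The hypothesis \<open>k < CARD('n)\<close> makes the truncated subtractions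
    agree, so words of the directional form have the length \<open>N - k\<close>.\<close>
  have p: "?n - k + ?m = ?p"
    using assms(1) by simp
  have len: "length J = ?p" if "J \<in> \<J>'" for J
    using length_listset[of J] that by (auto simp: \<J>'_def)
  have "finite \<J>'"
    unfolding \<J>'_def by (rule finite_listset) simp
  have "\<J> \<subseteq> \<J>'"
  proof
    fix J assume "J \<in> \<J>"
    then have "length J = ?p"
      using length_listset p by (fastforce simp: \<J>_def)
    then show "J \<in> \<J>'"
      using mem_listset_replicate_UNIV[of J] by (simp add: \<J>'_def)
  qed
  obtain M' where M': "represented_by (current_wedge T (\<lambda>_ vs. \<Sum>J\<in>\<J>'. theta_word J vs)) M'"
    using theta_words_represented[OF assms(2) \<open>finite \<J>'\<close> len] by blast
  \<comment> \<open>Finiteness matters below: \<open>measure\<close> assigns 0 to sets of infinite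
    mass, so it inherits monotonicity from \<open>emeasure\<close> only when the larger side is
    finite.\<close>
  then have fin: "emeasure (?M \<J>') (ball a r) < \<infinity>" for a r
    by (auto simp: current_measure_eq[OF M'] represented_by_iff intro!: radon_ball_finite
        simp flip: infinity_ennreal_def)
  have sets': "sets (?M \<J>') = sets borel"
    using M' by (simp add: current_measure_eq[OF M'] represented_by_def)
  have nu: "nu k T r = 1 / r ^ (2 * ?p) * measure (?M \<J>') (ball 0 r)" for r
    by (simp add: nu_def Let_def beta_power \<J>'_def)
  have dnu: "directional_nu k T D r = 1 / r ^ (2 * (?n - k)) * measure (?M \<J>) (ball 0 r \<times> D)" for r
    by (simp add: directional_nu_def beta_z_beta_t_power \<J>_def)
  have "bounded D"
    using assms(5) bounded_subset[OF compact_imp_bounded closure_subset] by blast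
  then obtain s where s: "\<And>t. t \<in> D \<Longrightarrow> norm t \<le> s"
    unfolding bounded_iff by blast
  have le: "directional_nu k T D r \<le> 2 ^ (2 * ?p) * r ^ (2 * ?m) * nu k T (2 * r)"
    if r: "r \<ge> 1" "r \<ge> s" for r
  proof -
    have "ball 0 r \<times> D \<subseteq> (ball 0 (2 * r) :: ('n, 'm) cspace set)"
    proof
      fix x :: "('n, 'm) cspace" assume x: "x \<in> ball 0 r \<times> D"
      have "norm x \<le> norm (fst x) + norm (snd x)"
        using norm_Pair_le[of "fst x" "snd x"] by simp
      \<comment> \<open>Here \<open>r \<ge> s\<close> bounds the second component by
        \<open>r\<close>; strictness comes from the open ball in the first.\<close>
      also have "\<dots> < r + r"
        using x s[of "snd x"] r by (cases x) auto
      finally show "x \<in> ball 0 (2 * r)" by simp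
    qed
    moreover have "ball 0 r \<times> D \<in> sets (borel :: ('n, 'm) cspace measure)"
      using assms(4) by (intro borel_Times) auto
    ultimately have "emeasure (?M \<J>) (ball 0 r \<times> D) \<le> emeasure (?M \<J>') (ball 0 (2 * r))"
      using current_measure_theta_words_mono[OF assms(2) \<open>finite \<J>'\<close> \<open>\<J> \<subseteq> \<J>'\<close> len, of "ball 0 r \<times> D"]
        emeasure_mono[of "ball 0 r \<times> D" "ball 0 (2 * r)" "?M \<J>'"] sets'
      by (auto intro: order.trans)
    then have "measure (?M \<J>) (ball 0 r \<times> D) \<le> measure (?M \<J>') (ball 0 (2 * r))"
      using fin[of 0 "2 * r"] unfolding measure_def by (intro enn2real_mono) auto
    then have "directional_nu k T D r \<le> 1 / r ^ (2 * (?n - k)) * measure (?M \<J>') (ball 0 (2 * r))"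
      using r unfolding dnu by (intro mult_left_mono) auto
    \<comment> \<open>The normalisation of \<open>nu\<close> at radius \<open>2 * r\<close> is
      \<open>1 / (2 * r) ^ (2 * ?p)\<close>. Compensating it produces the constant
      \<open>2 ^ (2 * ?p)\<close> and the surplus power \<open>r ^ (2 * ?m)\<close>, the source of
      \<open>2m\<close> in the bound.\<close>
    also have "1 / r ^ (2 * (?n - k)) = 2 ^ (2 * ?p) * r ^ (2 * ?m) * (1 / (2 * r) ^ (2 * ?p))"
    proof -
      have "2 * ?p = 2 * ?m + 2 * (?n - k)"
        using p by simp
      then show ?thesis
        using r unfolding power_mult_distrib by (simp only: power_add) simp
    qed
    finally show ?thesis
      by (simp add: nu mult.assoc)
  qed
  have "directional_order k T D \<le> ereal (real (2 * ?m)) + current_order k T"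
    unfolding directional_order_def current_order_def
  proof (rule growth_order_le)
    show "eventually (\<lambda>r. directional_nu k T D r \<le> 2 ^ (2 * ?p) * r ^ (2 * ?m) * nu k T (2 * r)) at_top"
      using eventually_ge_at_top[of 1] eventually_ge_at_top[of s] by eventually_elim (rule le)
    show "directional_nu k T D r \<ge> 0" "nu k T r \<ge> 0" for r
      by (simp_all add: dnu nu)
    show "growth_order (nu k T) < \<infinity>"
      using assms(6) by (simp add: current_order_def)
  qed simp
  moreover have "ereal (real (2 * ?m)) + current_order k T < \<infinity>"
    using assms(6) by (cases "current_order k T") auto
  ultimately show ?thesis by (auto intro: le_less_trans)
qed

end
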